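(* Let $(X_k)_{k\ge 0}$ be a sequence of independent real-valued random variables on a probability space $(\Omega,\mathcal A,\mathbb P)$ satisfying one of the following: (polynomial case) there exist $\beta>0$ and $d>0$ with $\mathbb E|X_k|^\beta=\mathcal O(k^d)$; or (subexponential case) there exist $\beta>0$ and $\gamma\in(0,1)$ with $\mathbb E|X_k|^\beta=\mathcal O(2^{k^\gamma})$. Define, for $n\ge 1$, $$c_n=\begin{cases}1+\sqrt{\log n} & \text{in the polynomial case},\\ n^{-\gamma/2} & \text{in the subexponential case}.\end{cases}$$ Assume that, for every compact set $K\subset\mathbb R$ not containing $0$, $$\sup_{N\ge 1}\ \sup_{\alpha\in K}\ \sup_{j\in\mathbb Z\setminus\{0\}}\left|\sum_{k=0}^N\varphi_{X_k}(j\alpha)\right|<\infty .$$ Let $(a_k)_{k\ge 0}$ be a sequence of complex numbers such that (1) $\displaystyle\sum_{n\ge 1}\frac{\sqrt{\sum_{k\ge n}|a_k|^2}}{n\,c_n}<+\infty$; (2) $\displaystyle\sum_{k\ge 1}|a_k-a_{k+1}|$ converges. Then there exists a measurable set $\Omega_0$ with $\mathbb P(\Omega_0)=1$ such that for all $\omega\in\Omega_0$ and all $f\in B(\mathbb T)$ with $\int_{\mathbb T}f(t)\,dt=0$: for every $\alpha\in\mathbb R\setminus\{0\}$ the series $$F(\alpha,\omega)=\sum_{k=0}^\infty a_k f(\alpha X_k(\omega))$$ is well defined, the function $\alpha\mapsto F(\alpha,\omega)$ is continuous on $\mathbb R\setminus\{0\}$, and the series defining $F$ converges uniformly in $\alpha$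 on every compact subset of $\mathbb R$ not containing $0$.
   Context: $\mathbb T=\mathbb R/\mathbb Z$, and functions on $\mathbb T$ are identified with $1$-periodic functions on $\mathbb R$. $B(\mathbb T)$ is the set of functions $f:\mathbb T\to\mathbb C$ of the form $f(\alpha)=\sum_{j\in\mathbb Z}\hat f(j)\exp(2i\pi\alpha j)$ with $$|||f|||:=\sum_{j\in\mathbb Z}|\hat f(j)|\sqrt{\log(|j|+3)}<+\infty .$$ For a real random variable $X$, $\varphi_X(t)=\mathbb E(e^{2i\pi tX})$ for $t\in\mathbb R$. The symbol $\mathcal O$ is understood as $k\to\infty$. The set $\Omega_0$ does not depend on $f$. *)

theory Defs
  imports "HOL-Probability.Probability" "HOL-Library.Landau_Symbols"
begin

text \<open>Functions on \<open>\<real>/\<int>\<close> are represented by 1-periodic functions on \<open>\<real>\<close>.\<close>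

definition fourier_coeff :: "(real \<Rightarrow> complex) \<Rightarrow> int \<Rightarrow> complex" where
  "fourier_coeff f j =
     integral {0..1} (\<lambda>t. f t * exp (- (2 * \<i> * of_real pi * of_real t * of_int j)))"

definition B_space :: "(real \<Rightarrow> complex) set" where
  "B_space = {f.
     (\<forall>t. f (t + 1) = f t) \<and>
     (\<forall>\<alpha>. ((\<lambda>j. fourier_coeff f j * exp (2 * \<i> * of_real pi * of_real \<alpha> * of_int j))
            has_sum f \<alpha>) UNIV) \<and>
     (\<lambda>j. cmod (fourier_coeff f j) * sqrt (ln (real_of_int \<bar>j\<bar> + 3))) summable_on UNIV}"

definition phi :: "'w measure \<Rightarrow> ('w \<Rightarrow> real) \<Rightarrow> real \<Rightarrow> complex" where
  "phi M X t = (\<integral>\<omega>. exp (2 * \<i> * of_real pi * of_real t * of_real (X \<omega>)) \<partial>M)"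

text \<open>The Bochner integral of a non-integrable function is 0, so finiteness of the moments
  for all large \<open>k\<close>, which is implicit in the \<open>O\<close>-bound, is stated separately.\<close>

definition moments_bigo ::
  "'w measure \<Rightarrow> (nat \<Rightarrow> 'w \<Rightarrow> real) \<Rightarrow> real \<Rightarrow> (nat \<Rightarrow> real) \<Rightarrow> bool" where
  "moments_bigo M X \<beta> g \<longleftrightarrow>
     (\<forall>\<^sub>F k in sequentially. integrable M (\<lambda>\<omega>. \<bar>X k \<omega>\<bar> powr \<beta>)) \<and>
     (\<lambda>k. \<integral>\<omega>. \<bar>X k \<omega>\<bar> powr \<beta> \<partial>M) \<in> O(g)"

text \<open>The weights \<open>c\<close> depend on which moment bound holds; only \<open>c n\<close> for \<open>n \<ge> 1\<close> matters.\<close>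

definition polynomial_case ::
  "'w measure \<Rightarrow> (nat \<Rightarrow> 'w \<Rightarrow> real) \<Rightarrow> (nat \<Rightarrow> real) \<Rightarrow> bool" where
  "polynomial_case M X c \<longleftrightarrow>
     (\<exists>\<beta>>0. \<exists>d>0. moments_bigo M X \<beta> (\<lambda>k. real k powr d)) \<and>
     (\<forall>n\<ge>1. c n = 1 + sqrt (ln (real n)))"

definition subexponential_case ::
  "'w measure \<Rightarrow> (nat \<Rightarrow> 'w \<Rightarrow> real) \<Rightarrow> (nat \<Rightarrow> real) \<Rightarrow> bool" where
  "subexponential_case M X c \<longleftrightarrow>
     (\<exists>\<beta>>0. \<exists>\<gamma>. 0 < \<gamma> \<and> \<gamma> < 1 \<and>
        moments_bigo M X \<beta> (\<lambda>k. 2 powr (real k powr \<gamma>)) \<and>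
        (\<forall>n\<ge>1. c n = real n powr (- \<gamma> / 2)))"

end

theory Submission
  imports Defs
begin

text \<open>
  Split \<open>exp (2\<pi>itX\<^sub>k)\<close> into its mean and a centred part. For the means the partial sums are
  bounded, so summation by parts with the bounded variation of \<open>a\<close> gives uniform convergence.
  For the centred part, cut \<open>\<nat>\<close> into blocks \<open>[n\<^sub>i, n\<^sub>i\<^sub>+\<^sub>1)\<close> on which the indices and the moments are
  at most \<open>exp L\<^sub>i\<close>. Hoeffding's inequality and a union bound, over a grid in \<open>t\<close> of mesh
  \<open>exp (-O(L\<^sub>i))\<close> and over all partial sums of the block, bound the latter almost surely, for all
  real \<open>t\<close> at once, by a multiple of \<open>r\<^sub>i * sqrt (L\<^sub>i * ln (\<bar>t\<bar> + 3))\<close>, where \<open>r\<^sub>i\<close> is the \<open>\<ell>\<^sup>2\<close> norm of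
  the tail of \<open>a\<close> from \<open>n\<^sub>i\<close> on; off the grid, a fractional Hoelder estimate needs only a small moment of \<open>X\<^sub>k\<close>.
  Hypothesis (1) makes \<open>r\<^sub>i * sqrt L\<^sub>i\<close> summable for \<open>n\<^sub>i = 2 ^ 2 ^ i\<close>, \<open>L\<^sub>i \<sim> 2 ^ i\<close> in the polynomial
  case and for \<open>n\<^sub>i = 2 ^ i\<close>, \<open>L\<^sub>i \<sim> n\<^sub>i powr \<gamma>\<close> in the subexponential case. With \<open>t = j * \<alpha>\<close> the factor
  \<open>sqrt (ln (\<bar>j\<bar> + 3))\<close> is absorbed by the norm of \<open>B\<close>.
\<close>



section \<open>Elementary estimates for complex exponentials\<close>

text \<open>Interpolates between the Lipschitz bound, used when \<bar>u - v\<bar> \<le> 1, and the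
  trivial bound 2. An exponent below 1 is what later makes a moment of small order
  sufficient.\<close>

lemma cmod_cis_diff_le_powr:
  fixes u v b :: real
  assumes "0 < b" "b \<le> 1"
  shows "cmod (cis u - cis v) \<le> 2 * \<bar>u - v\<bar> powr b"
proof -
  have "cis u - cis v = cis v * (iexp (u - v) - 1)"
    by (subst cis_conv_exp[symmetric]) (simp add: right_diff_distrib cis_mult del: of_real_diff)
  hence eq: "cmod (cis u - cis v) = cmod (iexp (u - v) - 1)"
    by (simp add: norm_mult)
  show ?thesis
  proof (cases "\<bar>u - v\<bar> \<le> 1")
    case True
    have "cmod (iexp (u - v) - 1) \<le> \<bar>u - v\<bar>"
      using iexp_approx1[of "u - v" 0] by simp
    also have "\<dots> \<le> \<bar>u - v\<bar> powr b"
      using powr_mono'[of b 1 "\<bar>u - v\<bar>"] True assms by simp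
    also have "\<dots> \<le> 2 * \<bar>u - v\<bar> powr b" by simp
    finally show ?thesis by (simp only: eq)
  next
    case False
    have "cmod (cis u - cis v) \<le> 2"
      using norm_triangle_ineq4[of "cis u" "cis v"] by simp
    moreover have "1 \<le> \<bar>u - v\<bar> powr b"
      using False assms by (intro ge_one_powr_ge_zero) auto
    ultimately show ?thesis by linarith
  qed
qed

text \<open>The shift by 3 exceeds e. Hence the weight \<open>sqrt (ln (\<bar>t\<bar> + 3))\<close>
  is at least 1 and can absorb additive constants.\<close>

lemma one_le_ln_add_3: "1 \<le> ln (\<bar>x\<bar> + 3 :: real)"
proof -
  have "ln (exp 1) \<le> ln (\<bar>x\<bar> + 3)"
    using exp_le by (subst ln_le_cancel_iff) auto
  thus ?thesis by simp
qed

lemma exp_2_pi_i_eq_cis: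
  "exp (2 * \<i> * of_real pi * of_real t * of_real x) = cis (2 * pi * (t * x))"
  by (simp add: cis_conv_exp mult_ac)

lemma phi_eq_integral_cis: "phi M X t = (\<integral>\<omega>. cis (2 * pi * (t * X \<omega>)) \<partial>M)"
  by (simp add: phi_def exp_2_pi_i_eq_cis)

lemma borel_measurable_cis [measurable]: "cis \<in> borel_measurable borel"
  by (intro borel_measurable_continuous_onI continuous_on_cis continuous_on_id)

lemma integrable_cis:
  assumes "prob_space M" and [measurable]: "X \<in> borel_measurable M"
  shows "integrable M (\<lambda>\<omega>. cis (2 * pi * (t * X \<omega>)))"
proof -
  interpret prob_space M by fact
  show ?thesis by (rule integrable_const_bound[of _ 1]) auto
qed

section \<open>Concentration of the centred sums on a block\<close>

text \<open>The index set stays a parameter because both blocks \<open>{n..<m}\<close> and initial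
  segments \<open>{..<m}\<close> occur.\<close>

definition centred_sum ::
  "'w measure \<Rightarrow> (nat \<Rightarrow> 'w \<Rightarrow> real) \<Rightarrow> (nat \<Rightarrow> complex) \<Rightarrow> nat set \<Rightarrow> real \<Rightarrow> 'w \<Rightarrow> complex" where
  "centred_sum M X a I t \<omega> = (\<Sum>k\<in>I. a k * (cis (2 * pi * (t * X k \<omega>)) - phi M (X k) t))"

lemma borel_measurable_centred_sum [measurable]:
  assumes [measurable]: "\<And>k. X k \<in> borel_measurable M"
  shows "centred_sum M X a I t \<in> borel_measurable M"
  unfolding centred_sum_def by measurable

context prob_space
begin

text \<open>Hoeffding's inequality is about real variables, so the complex summands are first
  projected by \<open>T\<close>, later \<open>Re\<close> and \<open>Im\<close>. The projected
  summands lie in intervals of length \<open>2 * cmod (a k)\<close>; positivity of the sum of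
  squares permits dividing by it in the exponent.\<close>

lemma Hoeffding_weighted_cis_linear:
  fixes X :: "nat \<Rightarrow> 'a \<Rightarrow> real" and a :: "nat \<Rightarrow> complex" and T :: "complex \<Rightarrow> real"
  assumes indep: "indep_vars (\<lambda>_. borel) X UNIV" and "finite I"
    and T: "bounded_linear T" "\<And>z. \<bar>T z\<bar> \<le> cmod z"
    and r: "(\<Sum>k\<in>I. (cmod (a k))\<^sup>2) \<le> r\<^sup>2" "(\<Sum>k\<in>I. (cmod (a k))\<^sup>2) > 0" and "l \<ge> 0" "r > 0"
  shows "prob {\<omega>\<in>space M. r * l \<le> \<bar>T (centred_sum M X a I t \<omega>)\<bar>} \<le> 2 * exp (- l\<^sup>2 / 2)"
proof -
  interpret T: bounded_linear T by fact
  have [measurable]: "X k \<in> borel_measurable M" for k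
    using indep by (auto simp: indep_vars_def)
  have [measurable]: "T \<in> borel_measurable borel"
    by (intro borel_measurable_continuous_onI T.continuous_on continuous_on_id)
  define Z where "Z k \<omega> = T (a k * cis (2 * pi * (t * X k \<omega>)))" for k \<omega>
  have abs_Z: "\<bar>Z k \<omega>\<bar> \<le> cmod (a k)" for k \<omega>
    using T(2)[of "a k * cis (2 * pi * (t * X k \<omega>))"] by (simp add: Z_def norm_mult)
  have EZ: "expectation (Z k) = T (a k * phi M (X k) t)" for k
  proof -
    have int: "integrable M (\<lambda>\<omega>. a k * cis (2 * pi * (t * X k \<omega>)))"
      by (intro integrable_mult_right integrable_cis prob_space_axioms) auto
    show ?thesis
      unfolding Z_def integral_bounded_linear[OF T(1) int] phi_eq_integral_cis
      by simp
  qed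
  interpret Hoeffding_ineq M I Z "\<lambda>k. - cmod (a k)" "\<lambda>k. cmod (a k)" "\<Sum>k\<in>I. expectation (Z k)"
  proof unfold_locales
    show "indep_vars (\<lambda>_. borel) Z I"
      unfolding Z_def
      by (rule indep_vars_compose2[OF indep_vars_subset[OF indep]]) auto
    show "AE \<omega> in M. Z k \<omega> \<in> {- cmod (a k)..cmod (a k)}" for k
      using abs_Z by (auto simp: abs_le_iff minus_le_iff)
  qed (use \<open>finite I\<close> in auto)
  have S: "(\<Sum>k\<in>I. (cmod (a k) - - cmod (a k))\<^sup>2) = 4 * (\<Sum>k\<in>I. (cmod (a k))\<^sup>2)"
    by (simp add: sum_distrib_left power2_eq_square)
  have "T (centred_sum M X a I t \<omega>) = (\<Sum>k\<in>I. Z k \<omega>) - (\<Sum>k\<in>I. expectation (Z k))" for \<omega>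
    by (simp add: centred_sum_def EZ Z_def T.sum T.diff algebra_simps sum_subtractf)
  hence "prob {\<omega>\<in>space M. r * l \<le> \<bar>T (centred_sum M X a I t \<omega>)\<bar>}
      = prob {\<omega>\<in>space M. r * l \<le> \<bar>(\<Sum>k\<in>I. Z k \<omega>) - (\<Sum>k\<in>I. expectation (Z k))\<bar>}"
    by simp
  also have "\<dots> \<le> 2 * exp (- 2 * (r * l)\<^sup>2 / (4 * (\<Sum>k\<in>I. (cmod (a k))\<^sup>2)))"
    using Hoeffding_ineq_abs_ge[of "r * l"] r \<open>l \<ge> 0\<close> \<open>r > 0\<close> unfolding S by simp
  also have "- 2 * (r * l)\<^sup>2 / (4 * (\<Sum>k\<in>I. (cmod (a k))\<^sup>2)) \<le> - l\<^sup>2 / 2"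
    using mult_left_mono[OF r(1), of "l\<^sup>2"] r(2) by (simp add: field_simps power_mult_distrib)
  finally show ?thesis by simp
qed

text \<open>A complex number of modulus at least \<open>2 * r * l\<close> has a real or an imaginary
  part of size at least \<open>r * l\<close>, whence the factor 4. If all coefficients vanish, the
  event is empty for \<open>l > 0\<close>, while for \<open>l = 0\<close> the right side is
  4.\<close>

lemma Hoeffding_weighted_cis:
  fixes X :: "nat \<Rightarrow> 'a \<Rightarrow> real" and a :: "nat \<Rightarrow> complex"
  assumes indep: "indep_vars (\<lambda>_. borel) X UNIV" and "finite I"
    and r: "(\<Sum>k\<in>I. (cmod (a k))\<^sup>2) \<le> r\<^sup>2" and "l \<ge> 0" "r > 0"
  shows "prob {\<omega>\<in>space M. 2 * r * l \<le> cmod (centred_sum M X a I t \<omega>)} \<le> 4 * exp (- l\<^sup>2 / 2)"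
proof (cases "(\<Sum>k\<in>I. (cmod (a k))\<^sup>2) > 0")
  case True
  have [measurable]: "X k \<in> borel_measurable M" for k
    using indep by (auto simp: indep_vars_def)
  let ?S = "centred_sum M X a I t"
  have "prob {\<omega>\<in>space M. 2 * r * l \<le> cmod (?S \<omega>)}
     \<le> prob ({\<omega>\<in>space M. r * l \<le> \<bar>Re (?S \<omega>)\<bar>} \<union> {\<omega>\<in>space M. r * l \<le> \<bar>Im (?S \<omega>)\<bar>})"
  proof (intro finite_measure_mono subsetI)
    fix \<omega> assume "\<omega> \<in> {\<omega>\<in>space M. 2 * r * l \<le> cmod (?S \<omega>)}"
    thus "\<omega> \<in> {\<omega>\<in>space M. r * l \<le> \<bar>Re (?S \<omega>)\<bar>} \<union> {\<omega>\<in>space M. r * l \<le> \<bar>Im (?S \<omega>)\<bar>}"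
      using cmod_le[of "?S \<omega>"] by auto
  qed auto
  also have "\<dots> \<le> prob {\<omega>\<in>space M. r * l \<le> \<bar>Re (?S \<omega>)\<bar>} + prob {\<omega>\<in>space M. r * l \<le> \<bar>Im (?S \<omega>)\<bar>}"
    by (intro measure_Un_le) auto
  also have "\<dots> \<le> 2 * exp (- l\<^sup>2 / 2) + 2 * exp (- l\<^sup>2 / 2)"
    by (intro add_mono Hoeffding_weighted_cis_linear assms True bounded_linear_Re
        bounded_linear_Im abs_Re_le_cmod abs_Im_le_cmod)
  finally show ?thesis by simp
next
  case False
  hence "(\<Sum>k\<in>I. (cmod (a k))\<^sup>2) = 0"
    using sum_nonneg[of I "\<lambda>k. (cmod (a k))\<^sup>2"] by simp
  hence "\<forall>k\<in>I. a k = 0"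
    using \<open>finite I\<close> by (subst (asm) sum_nonneg_eq_0_iff) auto
  hence 0: "centred_sum M X a I t \<omega> = 0" for \<omega>
    by (simp add: centred_sum_def)
  show ?thesis
  proof (cases "l = 0")
    case True
    have "prob {\<omega>\<in>space M. 2 * r * l \<le> cmod (centred_sum M X a I t \<omega>)} \<le> 1" by (rule prob_le_1)
    thus ?thesis using True by (simp del: prob_le_1)
  next
    case False
    hence "2 * r * l > 0" using \<open>l \<ge> 0\<close> \<open>r > 0\<close> by simp
    thus ?thesis using 0 by (simp add: not_le)
  qed
qed

text \<open>The threshold is chosen so that Hoeffding gives
  \<open>4 * exp (- 2 * L) / (q + 3)^2\<close> at each grid point, which is summable over the
  infinite grid. The two signs cost a factor 2 and the partial sums a factor at most
  \<open>N + 1 \<le> 2 * exp L\<close>, so \<open>exp (- L)\<close> survives. The mesh is arbitrary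
  here.\<close>

lemma centred_sum_grid_bound:
  fixes X :: "nat \<Rightarrow> 'a \<Rightarrow> real" and a :: "nat \<Rightarrow> complex"
  assumes indep: "indep_vars (\<lambda>_. borel) X UNIV"
    and r: "(\<Sum>k\<in>{n..<N}. (cmod (a k))\<^sup>2) \<le> r\<^sup>2" "r > 0" and L: "real N \<le> exp L" "0 \<le> L"
  shows "prob (\<Union>m\<in>{n..N}. \<Union>s\<in>{1, -1}. \<Union>q. {\<omega>\<in>space M.
            2 * r * sqrt (4 * (L + ln (real q + 3))) \<le> cmod (centred_sum M X a {n..<m} (s * (real q * \<delta>)) \<omega>)})
         \<le> 16 * (\<Sum>q. 1 / (real q + 3)\<^sup>2) * exp (- L)"
proof -
  have [measurable]: "X k \<in> borel_measurable M" for k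
    using indep by (auto simp: indep_vars_def)
  define A where "A m s q = {\<omega>\<in>space M.
    2 * r * sqrt (4 * (L + ln (real q + 3))) \<le> cmod (centred_sum M X a {n..<m} (s * (real q * \<delta>)) \<omega>)}" for m s q
  have A [measurable]: "A m s q \<in> sets M" for m s q
    unfolding A_def by measurable
  define Z where "Z = (\<Sum>q. 1 / (real q + 3)\<^sup>2)"
  have summ: "summable (\<lambda>q. 1 / (real q + 3)\<^sup>2)"
    using summable_ignore_initial_segment[OF inverse_power_summable[of 2, where 'a = real], of 3]
    by (simp add: inverse_eq_divide add_ac)
  have PA: "prob (A m s q) \<le> 4 * exp (- 2 * L) * (1 / (real q + 3)\<^sup>2)" if "m \<in> {n..N}" for m s q
  proof -
    let ?l = "sqrt (4 * (L + ln (real q + 3)))"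
    have ln: "ln (real q + 3) \<ge> 0" by simp
    have "(\<Sum>k\<in>{n..<m}. (cmod (a k))\<^sup>2) \<le> (\<Sum>k\<in>{n..<N}. (cmod (a k))\<^sup>2)"
      using that by (intro sum_mono2) auto
    with r have "prob (A m s q) \<le> 4 * exp (- ?l\<^sup>2 / 2)"
      unfolding A_def using L ln by (intro Hoeffding_weighted_cis indep) auto
    also have "- ?l\<^sup>2 / 2 = - 2 * L - 2 * ln (real q + 3)"
      using L ln by simp
    also have "4 * exp (- 2 * L - 2 * ln (real q + 3)) = 4 * exp (- 2 * L) * (1 / (real q + 3)\<^sup>2)"
    proof -
      have "exp (2 * ln (real q + 3)) = (real q + 3)\<^sup>2"
        by (simp add: exp_double)
      thus ?thesis by (simp add: exp_diff)
    qed
    finally show ?thesis .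
  qed
  have PU: "prob (\<Union>q. A m s q) \<le> 4 * exp (- 2 * L) * Z" if "m \<in> {n..N}" for m s
  proof -
    have s: "summable (\<lambda>q. prob (A m s q))"
      by (rule summable_comparison_test'[OF summable_mult[OF summ, of "4 * exp (- 2 * L)"]])
         (use PA[OF that] in auto)
    have "prob (\<Union>q. A m s q) \<le> (\<Sum>q. prob (A m s q))"
      by (rule finite_measure_subadditive_countably) (use s in auto)
    also have "\<dots> \<le> (\<Sum>q. 4 * exp (- 2 * L) * (1 / (real q + 3)\<^sup>2))"
      by (intro suminf_le PA that s summable_mult summ)
    also have "\<dots> = 4 * exp (- 2 * L) * Z"
      unfolding Z_def by (rule suminf_mult[OF summ])
    finally show ?thesis .
  qed
  have Z: "Z \<ge> 0" unfolding Z_def by (intro suminf_nonneg summ) auto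
  have "prob (\<Union>m\<in>{n..N}. \<Union>s\<in>{1, -1}. \<Union>q. A m s q)
      \<le> (\<Sum>m\<in>{n..N}. prob (\<Union>s\<in>{1, -1}. \<Union>q. A m s q))"
    by (intro finite_measure_subadditive_finite) auto
  also have "\<dots> \<le> (\<Sum>m\<in>{n..N}. \<Sum>s\<in>{1, -1}. prob (\<Union>q. A m s q))"
    by (intro sum_mono finite_measure_subadditive_finite) auto
  also have "\<dots> \<le> (\<Sum>m\<in>{n..N}. \<Sum>s\<in>{1, -1 :: real}. 4 * exp (- 2 * L) * Z)"
    by (intro sum_mono PU)
  also have "\<dots> = real (card {n..N}) * (8 * exp (- 2 * L) * Z)"
    by simp
  also have "\<dots> \<le> (2 * exp L) * (8 * exp (- 2 * L) * Z)"
  proof (rule mult_right_mono)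
    have "real (card {n..N}) \<le> real N + 1" by simp
    also have "\<dots> \<le> 2 * exp L" using L one_le_exp_iff[of L] by linarith
    finally show "real (card {n..N}) \<le> 2 * exp L" .
  qed (use Z in auto)
  also have "\<dots> = 16 * Z * (exp L * exp (- 2 * L))" by simp
  also have "exp L * exp (- 2 * L) = exp (- L)"
    by (simp flip: exp_add)
  finally show ?thesis unfolding A_def Z_def by simp
qed

text \<open>There are at most \<open>exp L\<close> terms of mean at most \<open>exp L\<close>, so
  the sum has mean at most \<open>exp (2 * L)\<close>; Markov's inequality at level
  \<open>exp (3 * L)\<close> then gains \<open>exp (- L)\<close>.\<close>

lemma sum_moments_tail_bound:
  fixes Y :: "nat \<Rightarrow> 'a \<Rightarrow> real"
  assumes Y: "\<And>k. k \<in> {n..<N} \<Longrightarrow> integrable M (Y k)" "\<And>k \<omega>. 0 \<le> Y k \<omega>"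
    "\<And>k. k \<in> {n..<N} \<Longrightarrow> expectation (Y k) \<le> exp L" and L: "real N \<le> exp L"
  shows "prob {\<omega>\<in>space M. exp (3 * L) \<le> (\<Sum>k=n..<N. Y k \<omega>)} \<le> exp (- L)"
    and "(\<Sum>k=n..<N. expectation (Y k)) \<le> exp (2 * L)"
proof -
  have "(\<Sum>k=n..<N. expectation (Y k)) \<le> real (card {n..<N}) * exp L"
    using Y(3) by (intro sum_bounded_above) auto
  also have "\<dots> \<le> exp L * exp L"
    using L by (intro mult_right_mono) auto
  also have "\<dots> = exp (2 * L)" by (simp flip: exp_add)
  finally show *: "(\<Sum>k=n..<N. expectation (Y k)) \<le> exp (2 * L)" .
  have "prob {\<omega>\<in>space M. exp (3 * L) \<le> (\<Sum>k=n..<N. Y k \<omega>)}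
      \<le> expectation (\<lambda>\<omega>. \<Sum>k=n..<N. Y k \<omega>) / exp (3 * L)"
    by (rule integral_Markov_inequality_measure[where A = "space M"])
       (use Y in \<open>auto intro!: sum_nonneg Bochner_Integration.integrable_sum\<close>)
  also have "expectation (\<lambda>\<omega>. \<Sum>k=n..<N. Y k \<omega>) = (\<Sum>k=n..<N. expectation (Y k))"
    by (rule Bochner_Integration.integral_sum) (use Y in auto)
  also have "\<dots> / exp (3 * L) \<le> exp (2 * L) / exp (3 * L)"
    using * by (intro divide_right_mono) auto
  also have "\<dots> = exp (- L)" by (simp flip: exp_diff)
  finally show "prob {\<omega>\<in>space M. exp (3 * L) \<le> (\<Sum>k=n..<N. Y k \<omega>)} \<le> exp (- L)" .
qed

lemma phi_Holder:
  assumes [measurable]: "Y \<in> borel_measurable M" and b: "0 < b" "b \<le> 1"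
    and int: "integrable M (\<lambda>\<omega>. \<bar>Y \<omega>\<bar> powr b)"
  shows "cmod (phi M Y t - phi M Y s) \<le> 2 * (2 * pi * \<bar>t - s\<bar>) powr b * expectation (\<lambda>\<omega>. \<bar>Y \<omega>\<bar> powr b)"
proof -
  have eq: "phi M Y t - phi M Y s = expectation (\<lambda>\<omega>. cis (2 * pi * (t * Y \<omega>)) - cis (2 * pi * (s * Y \<omega>)))"
    unfolding phi_eq_integral_cis
    by (rule Bochner_Integration.integral_diff[symmetric]) (auto intro!: integrable_cis prob_space_axioms)
  have "cmod (phi M Y t - phi M Y s)
      \<le> expectation (\<lambda>\<omega>. cmod (cis (2 * pi * (t * Y \<omega>)) - cis (2 * pi * (s * Y \<omega>))))"
    unfolding eq by (rule integral_norm_bound)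
  also have "\<dots> \<le> expectation (\<lambda>\<omega>. 2 * (2 * pi * \<bar>t - s\<bar>) powr b * \<bar>Y \<omega>\<bar> powr b)"
  proof (rule integral_mono)
    show "integrable M (\<lambda>\<omega>. cmod (cis (2 * pi * (t * Y \<omega>)) - cis (2 * pi * (s * Y \<omega>))))"
      by (intro integrable_norm Bochner_Integration.integrable_diff integrable_cis prob_space_axioms) auto
  next
    fix \<omega>
    have "\<bar>2 * pi * (t * Y \<omega>) - 2 * pi * (s * Y \<omega>)\<bar> = 2 * pi * \<bar>t - s\<bar> * \<bar>Y \<omega>\<bar>"
      by (simp add: abs_mult flip: right_diff_distrib left_diff_distrib)
    thus "cmod (cis (2 * pi * (t * Y \<omega>)) - cis (2 * pi * (s * Y \<omega>))) \<le> 2 * (2 * pi * \<bar>t - s\<bar>) powr b * \<bar>Y \<omega>\<bar> powr b"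
      using cmod_cis_diff_le_powr[OF b, of "2 * pi * (t * Y \<omega>)" "2 * pi * (s * Y \<omega>)"]
      by (simp add: powr_mult)
  qed (use int in auto)
  finally show ?thesis using int by simp
qed

text \<open>The Hoelder estimate is applied to each exponential and, through
  \<open>phi_Holder\<close>, to its mean. The constant involves only realised and expected moments
  of order \<open>b\<close>, both of which are controlled on a block.\<close>

lemma centred_sum_Holder:
  fixes X :: "nat \<Rightarrow> 'a \<Rightarrow> real" and a :: "nat \<Rightarrow> complex"
  assumes [measurable]: "\<And>k. X k \<in> borel_measurable M" and b: "0 < b" "b \<le> 1"
    and int: "\<And>k. k \<in> I \<Longrightarrow> integrable M (\<lambda>\<omega>. \<bar>X k \<omega>\<bar> powr b)"
    and a: "\<And>k. k \<in> I \<Longrightarrow> cmod (a k) \<le> r"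
  shows "cmod (centred_sum M X a I t \<omega> - centred_sum M X a I s \<omega>)
     \<le> 2 * r * (2 * pi * \<bar>t - s\<bar>) powr b *
       ((\<Sum>k\<in>I. \<bar>X k \<omega>\<bar> powr b) + (\<Sum>k\<in>I. expectation (\<lambda>\<omega>. \<bar>X k \<omega>\<bar> powr b)))"
proof -
  let ?E = "\<lambda>k. expectation (\<lambda>\<omega>. \<bar>X k \<omega>\<bar> powr b)"
  have eq: "centred_sum M X a I t \<omega> - centred_sum M X a I s \<omega> =
     (\<Sum>k\<in>I. a k * ((cis (2 * pi * (t * X k \<omega>)) - cis (2 * pi * (s * X k \<omega>)))
       - (phi M (X k) t - phi M (X k) s)))"
    by (simp add: centred_sum_def algebra_simps sum_subtractf sum.distrib)
  have "cmod (centred_sum M X a I t \<omega> - centred_sum M X a I s \<omega>)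
      \<le> (\<Sum>k\<in>I. r * (2 * (2 * pi * \<bar>t - s\<bar>) powr b * \<bar>X k \<omega>\<bar> powr b
      + 2 * (2 * pi * \<bar>t - s\<bar>) powr b * ?E k))"
    unfolding eq
  proof (rule sum_norm_le)
    fix k assume k: "k \<in> I"
    have "\<bar>2 * pi * (t * X k \<omega>) - 2 * pi * (s * X k \<omega>)\<bar> = 2 * pi * \<bar>t - s\<bar> * \<bar>X k \<omega>\<bar>"
      by (simp add: abs_mult flip: right_diff_distrib left_diff_distrib)
    hence "cmod (cis (2 * pi * (t * X k \<omega>)) - cis (2 * pi * (s * X k \<omega>))) \<le> 2 * (2 * pi * \<bar>t - s\<bar>) powr b * \<bar>X k \<omega>\<bar> powr b"
      using cmod_cis_diff_le_powr[OF b, of "2 * pi * (t * X k \<omega>)" "2 * pi * (s * X k \<omega>)"]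
      by (simp add: powr_mult)
    moreover have "cmod (phi M (X k) t - phi M (X k) s) \<le> 2 * (2 * pi * \<bar>t - s\<bar>) powr b * ?E k"
      using phi_Holder[of "X k", OF _ b int[OF k]] by simp
    moreover have "r \<ge> 0" using a[OF k] norm_ge_zero[of "a k"] by linarith
    ultimately show "cmod (a k * ((cis (2 * pi * (t * X k \<omega>)) - cis (2 * pi * (s * X k \<omega>)))
       - (phi M (X k) t - phi M (X k) s))) \<le> r * (2 * (2 * pi * \<bar>t - s\<bar>) powr b * \<bar>X k \<omega>\<bar> powr b
      + 2 * (2 * pi * \<bar>t - s\<bar>) powr b * ?E k)"
      unfolding norm_mult using a[OF k]
      by (intro mult_mono order_trans[OF norm_triangle_ineq4 add_mono] norm_ge_zero)
  qed
  also have "\<dots> = 2 * r * (2 * pi * \<bar>t - s\<bar>) powr b * ((\<Sum>k\<in>I. \<bar>X k \<omega>\<bar> powr b) + (\<Sum>k\<in>I. ?E k))"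
    by (simp add: sum_distrib_left sum_distrib_right sum.distrib algebra_simps)
  finally show ?thesis .
qed

text \<open>The mesh \<delta> is chosen so that
  \<open>(2 * pi * \<delta>) powr b = exp (- (3 * L))\<close> cancels the moment sums: moving from
  \<open>t\<close> to a grid point costs only \<open>4 * r\<close>. At the grid point the logarithm
  of the index is at most ln (\<bar>t\<bar> + 3) + 3 + 3 * L / b, which the product of
  \<open>L\<close> and ln (\<bar>t\<bar> + 3) absorbs.\<close>

lemma centred_sum_from_grid:
  fixes X :: "nat \<Rightarrow> 'a \<Rightarrow> real" and a :: "nat \<Rightarrow> complex"
  assumes X: "\<And>k. X k \<in> borel_measurable M" and b: "0 < b" "b \<le> 1" and L: "1 \<le> L" and r: "0 \<le> r"
    and int: "\<And>k. k \<in> I \<Longrightarrow> integrable M (\<lambda>\<omega>. \<bar>X k \<omega>\<bar> powr b)"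
    and a: "\<And>k. k \<in> I \<Longrightarrow> cmod (a k) \<le> r"
    and mom: "(\<Sum>k\<in>I. \<bar>X k \<omega>\<bar> powr b) \<le> exp (3 * L)"
       "(\<Sum>k\<in>I. expectation (\<lambda>\<omega>. \<bar>X k \<omega>\<bar> powr b)) \<le> exp (3 * L)"
    and grid: "\<And>s q. s \<in> {1, -1} \<Longrightarrow> cmod (centred_sum M X a I (s * (real q * (exp (- (3 * L / b)) / (2 * pi)))) \<omega>)
       \<le> 2 * r * sqrt (4 * (L + ln (real q + 3)))"
  shows "cmod (centred_sum M X a I t \<omega>) \<le> 4 * (1 + sqrt (5 + 3 / b)) * r * sqrt (L * ln (\<bar>t\<bar> + 3))"
proof -
  define \<delta> where "\<delta> = exp (- (3 * L / b)) / (2 * pi)"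
  define l where "l = ln (\<bar>t\<bar> + 3)"
  have \<delta>: "\<delta> > 0" by (simp add: \<delta>_def)
  have l: "l \<ge> 1" unfolding l_def by (rule one_le_ln_add_3)
  \<comment> \<open>The grid point \<open>u\<close> is \<open>t\<close> rounded towards 0;
    \<open>s\<close> carries the sign of \<open>t\<close>.\<close>
  define q where "q = nat \<lfloor>\<bar>t\<bar> / \<delta>\<rfloor>"
  define s :: real where "s = (if t \<ge> 0 then 1 else - 1)"
  define u where "u = s * (real q * \<delta>)"
  have s: "s \<in> {1, -1}" "s * \<bar>t\<bar> = t" "\<bar>s\<bar> = 1" by (auto simp: s_def)
  have "real q = of_int \<lfloor>\<bar>t\<bar> / \<delta>\<rfloor>"
    using \<delta> by (simp add: q_def)
  hence q: "real q \<le> \<bar>t\<bar> / \<delta>" "\<bar>t\<bar> / \<delta> \<le> real q + 1" by linarith+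
  hence "0 \<le> \<bar>t\<bar> - real q * \<delta>" "\<bar>t\<bar> - real q * \<delta> \<le> \<delta>"
    using \<delta> by (auto simp: field_simps)
  hence "\<bar>\<bar>t\<bar> - real q * \<delta>\<bar> \<le> \<delta>" by simp
  moreover have "t - u = s * (\<bar>t\<bar> - real q * \<delta>)"
    using s(2) by (simp add: u_def right_diff_distrib)
  ultimately have tu: "\<bar>t - u\<bar> \<le> \<delta>" using s(3) by (simp add: abs_mult)
  have "cmod (centred_sum M X a I t \<omega> - centred_sum M X a I u \<omega>)
     \<le> 2 * r * (2 * pi * \<bar>t - u\<bar>) powr b *
       ((\<Sum>k\<in>I. \<bar>X k \<omega>\<bar> powr b) + (\<Sum>k\<in>I. expectation (\<lambda>\<omega>. \<bar>X k \<omega>\<bar> powr b)))"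
    by (rule centred_sum_Holder[OF X b int a])
  also have "\<dots> \<le> 2 * r * (2 * pi * \<delta>) powr b * (exp (3 * L) + exp (3 * L))"
    using mom tu r b by (intro mult_mono add_mono mult_left_mono powr_mono2 mult_nonneg_nonneg
        add_nonneg_nonneg sum_nonneg integral_nonneg) auto
  also have "(2 * pi * \<delta>) powr b = exp (- (3 * L))"
    using b by (simp add: \<delta>_def powr_def)
  also have "2 * r * exp (- (3 * L)) * (exp (3 * L) + exp (3 * L)) = 4 * r"
    by (simp add: algebra_simps flip: exp_add)
  finally have 1: "cmod (centred_sum M X a I t \<omega> - centred_sum M X a I u \<omega>) \<le> 4 * r" .
  \<comment> \<open>The factor \<open>exp 3\<close> is there to absorb \<open>2 * pi\<close>, since
    \<open>2 * pi < 8 \<le> exp 3\<close>.\<close>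
  have "real q + 3 \<le> (\<bar>t\<bar> + 3) * (exp 3 * exp (3 * L / b))"
  proof -
    have "(1 + 1 :: real) ^ 3 \<le> exp 1 ^ 3" by (intro power_mono exp_ge_add_one_self) auto
    also have "\<dots> = exp 3" by (simp flip: exp_of_nat_mult)
    finally have e2: "2 * pi \<le> exp 3" using pi_less_4 by simp
    have e1: "1 \<le> exp (3 * L / b)" using L b by simp
    have "real q \<le> \<bar>t\<bar> * (2 * pi * exp (3 * L / b))"
      using q(1) by (simp add: \<delta>_def exp_minus field_simps)
    also have "\<dots> \<le> \<bar>t\<bar> * (exp 3 * exp (3 * L / b))"
      using e2 by (intro mult_left_mono mult_right_mono) auto
    finally have "real q \<le> \<bar>t\<bar> * (exp 3 * exp (3 * L / b))" .
    moreover have "1 * 1 \<le> exp 3 * exp (3 * L / b)"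
      using e1 by (intro mult_mono) auto
    ultimately show ?thesis by (simp add: distrib_right)
  qed
  hence "ln (real q + 3) \<le> ln ((\<bar>t\<bar> + 3) * (exp 3 * exp (3 * L / b)))"
    by (subst ln_le_cancel_iff) (auto intro!: mult_pos_pos)
  also have "\<dots> = l + (3 + 3 * L / b)"
    by (simp add: l_def ln_mult)
  finally have "L + ln (real q + 3) \<le> L + l + 3 + 3 / b * L" by simp
  \<comment> \<open>As \<open>L\<close> and \<open>l\<close> are both at least 1, each of
    \<open>L\<close>, \<open>l\<close> and 1 is at most \<open>L * l\<close>; the coefficients 1 + 1
    + 3 give the 5.\<close>
  also have "\<dots> \<le> L * l + L * l + 3 * (L * l) + 3 / b * (L * l)"
  proof -
    have "L * 1 \<le> L * l" "1 * l \<le> L * l" using L l by (auto intro!: mult_left_mono mult_right_mono)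
    moreover have "3 / b * (L * 1) \<le> 3 / b * (L * l)"
      using L l b by (intro mult_left_mono) auto
    moreover have "1 * 1 \<le> L * l" using L l by (intro mult_mono) auto
    ultimately show ?thesis by (intro add_mono) auto
  qed
  also have "\<dots> = (5 + 3 / b) * (L * l)" by (simp add: algebra_simps)
  finally have "sqrt (4 * (L + ln (real q + 3))) \<le> sqrt (4 * ((5 + 3 / b) * (L * l)))" by simp
  also have "\<dots> = 2 * (sqrt (5 + 3 / b) * sqrt (L * l))" by (simp add: real_sqrt_mult)
  finally have "cmod (centred_sum M X a I u \<omega>) \<le> 2 * r * (2 * (sqrt (5 + 3 / b) * sqrt (L * l)))"
    using grid[OF s(1), of q] mult_left_mono[of _ _ "2 * r"] r
    unfolding u_def \<delta>_def by (meson order_trans zero_le_mult_iff zero_le_numeral)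
  moreover have "4 * r * 1 \<le> 4 * r * sqrt (L * l)"
    using r L l mult_mono[of 1 L 1 l] by (intro mult_left_mono) auto
  moreover have "cmod (centred_sum M X a I t \<omega>) \<le> cmod (centred_sum M X a I u \<omega>)
     + cmod (centred_sum M X a I t \<omega> - centred_sum M X a I u \<omega>)"
    by (rule norm_triangle_sub)
  ultimately have "cmod (centred_sum M X a I t \<omega>) \<le>
      2 * r * (2 * (sqrt (5 + 3 / b) * sqrt (L * l))) + 4 * r * sqrt (L * l)"
    using 1 by linarith
  thus ?thesis by (simp add: l_def algebra_simps)
qed

text \<open>Borel-Cantelli for two bad events per block: \<open>G i\<close>, a large centred sum at
  some grid point, and \<open>H i\<close>, a large moment sum. Each has probability O(exp (- L i)),
  which is summable because \<open>L i \<ge> i + 1\<close>. Outside both, the passage from the grid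
  to all \<open>t\<close> applies to every partial sum of the block.\<close>

lemma AE_centred_sum_blocks:
  fixes X :: "nat \<Rightarrow> 'a \<Rightarrow> real" and a :: "nat \<Rightarrow> complex"
  assumes indep: "indep_vars (\<lambda>_. borel) X UNIV" and b: "0 < b" "b \<le> 1"
    and L: "\<And>i. real i + 1 \<le> L i" "\<And>i. real (nn (Suc i)) \<le> exp (L i)"
    and mom: "\<And>i k. k \<in> {nn i..<nn (Suc i)} \<Longrightarrow> integrable M (\<lambda>\<omega>. \<bar>X k \<omega>\<bar> powr b)"
       "\<And>i k. k \<in> {nn i..<nn (Suc i)} \<Longrightarrow> expectation (\<lambda>\<omega>. \<bar>X k \<omega>\<bar> powr b) \<le> exp (L i)"
    and r: "\<And>i. 0 \<le> r i" "\<And>i. (\<Sum>k\<in>{nn i..<nn (Suc i)}. (cmod (a k))\<^sup>2) \<le> (r i)\<^sup>2"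
  shows "AE \<omega> in M. \<forall>\<^sub>F i in sequentially. \<forall>m\<in>{nn i..nn (Suc i)}. \<forall>t.
     cmod (centred_sum M X a {nn i..<m} t \<omega>) \<le> 4 * (1 + sqrt (5 + 3 / b)) * r i * sqrt (L i * ln (\<bar>t\<bar> + 3))"
proof -
  have [measurable]: "X k \<in> borel_measurable M" for k
    using indep by (auto simp: indep_vars_def)
  define Z where "Z = (\<Sum>q. 1 / (real q + 3)\<^sup>2)"
  define \<delta> where "\<delta> i = exp (- (3 * L i / b)) / (2 * pi)" for i
  \<comment> \<open>For \<open>r i = 0\<close> the threshold would be 0 and the grid condition
    trivially true, so the bad event is set to be empty. The coefficients of the block vanish in
    that case.\<close>
  define G where "G i = (if r i = 0 then {} else (\<Union>m\<in>{nn i..nn (Suc i)}. \<Union>s\<in>{1, -1}. \<Union>q. {\<omega>\<in>space M.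
     2 * r i * sqrt (4 * (L i + ln (real q + 3)))
       \<le> cmod (centred_sum M X a {nn i..<m} (s * (real q * \<delta> i)) \<omega>)}))" for i
  define H where "H i = {\<omega>\<in>space M. exp (3 * L i) \<le> (\<Sum>k=nn i..<nn (Suc i). \<bar>X k \<omega>\<bar> powr b)}" for i
  have G [measurable]: "G i \<in> sets M" for i unfolding G_def by (cases "r i = 0") simp_all
  have H [measurable]: "H i \<in> sets M" for i unfolding H_def by measurable
  have L1: "1 \<le> L i" for i using L(1)[of i] by linarith
  have "summable (\<lambda>q. 1 / (real q + 3)\<^sup>2)"
    using summable_ignore_initial_segment[OF inverse_power_summable[of 2, where 'a = real], of 3]
    by (simp add: inverse_eq_divide add_ac)
  hence Z: "Z \<ge> 0" unfolding Z_def by (intro suminf_nonneg) auto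
  have PG: "prob (G i) \<le> 16 * Z * exp (- L i)" for i
  proof (cases "r i = 0")
    case False
    thus ?thesis
      using centred_sum_grid_bound[OF indep r(2), of i "L i" "\<delta> i"] L(2)[of i] L1[of i] r(1)[of i]
      by (simp add: G_def Z_def)
  qed (use Z in \<open>simp add: G_def\<close>)
  have PH: "prob (H i) \<le> exp (- L i)" for i
    unfolding H_def by (rule sum_moments_tail_bound) (use mom L in auto)
  have "prob (G i \<union> H i) \<le> (16 * Z + 1) * exp (- 1) ^ i" for i
  proof -
    have "prob (G i \<union> H i) \<le> prob (G i) + prob (H i)"
      by (intro measure_Un_le) auto
    also have "\<dots> \<le> (16 * Z + 1) * exp (- L i)"
      using PG[of i] PH[of i] by (simp add: distrib_right)
    also have "\<dots> \<le> (16 * Z + 1) * exp (real i * (- 1))"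
      using L(1)[of i] Z by (intro mult_left_mono) auto
    also have "exp (real i * (- 1)) = exp (- 1) ^ i" by (rule exp_of_nat_mult)
    finally show ?thesis .
  qed
  hence "summable (\<lambda>i. prob (G i \<union> H i))"
    by (intro summable_comparison_test'[OF summable_mult[OF summable_geometric[of "exp (- 1)"]],
          of 0 _ "16 * Z + 1"]) auto
  hence "AE \<omega> in M. \<forall>\<^sub>F i in sequentially. \<omega> \<in> space M - (G i \<union> H i)"
    by (intro borel_cantelli_AE1) (auto simp: emeasure_eq_measure)
  thus ?thesis
  proof eventually_elim
    case (elim \<omega>)
    thus ?case
    proof eventually_elim
      case (elim i)
      show ?case
      proof (intro ballI allI)
        fix m t assume m: "m \<in> {nn i..nn (Suc i)}"
        have sub: "{nn i..<m} \<subseteq> {nn i..<nn (Suc i)}" using m by auto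
        have ar: "cmod (a k) \<le> r i" if "k \<in> {nn i..<m}" for k
        proof -
          have "(cmod (a k))\<^sup>2 \<le> (\<Sum>k\<in>{nn i..<nn (Suc i)}. (cmod (a k))\<^sup>2)"
            by (rule member_le_sum) (use that sub in auto)
          also have "\<dots> \<le> (r i)\<^sup>2" by (rule r)
          finally show ?thesis by (rule power2_le_imp_le) (rule r)
        qed
        show "cmod (centred_sum M X a {nn i..<m} t \<omega>)
            \<le> 4 * (1 + sqrt (5 + 3 / b)) * r i * sqrt (L i * ln (\<bar>t\<bar> + 3))"
        proof (rule centred_sum_from_grid[OF _ b L1 r(1) _ ar])
          show "integrable M (\<lambda>\<omega>. \<bar>X k \<omega>\<bar> powr b)" if "k \<in> {nn i..<m}" for k
            using mom(1) sub that by blast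
          have "(\<Sum>k\<in>{nn i..<m}. \<bar>X k \<omega>\<bar> powr b) \<le> (\<Sum>k\<in>{nn i..<nn (Suc i)}. \<bar>X k \<omega>\<bar> powr b)"
            by (rule sum_mono2) (use sub in auto)
          also have "\<dots> \<le> exp (3 * L i)"
            using elim by (auto simp: H_def not_le)
          finally show "(\<Sum>k\<in>{nn i..<m}. \<bar>X k \<omega>\<bar> powr b) \<le> exp (3 * L i)" .
          have "(\<Sum>k\<in>{nn i..<m}. expectation (\<lambda>\<omega>. \<bar>X k \<omega>\<bar> powr b))
              \<le> (\<Sum>k\<in>{nn i..<nn (Suc i)}. expectation (\<lambda>\<omega>. \<bar>X k \<omega>\<bar> powr b))"
            by (rule sum_mono2) (use sub in auto)
          also have "\<dots> \<le> exp (2 * L i)"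
            by (rule sum_moments_tail_bound) (use mom L in auto)
          also have "\<dots> \<le> exp (3 * L i)" using L1[of i] by simp
          finally show "(\<Sum>k\<in>{nn i..<m}. expectation (\<lambda>\<omega>. \<bar>X k \<omega>\<bar> powr b)) \<le> exp (3 * L i)" .
        next
          fix s :: real and q :: nat assume s: "s \<in> {1, -1}"
          show "cmod (centred_sum M X a {nn i..<m} (s * (real q * (exp (- (3 * L i / b)) / (2 * pi)))) \<omega>)
            \<le> 2 * r i * sqrt (4 * (L i + ln (real q + 3)))"
          proof (cases "r i = 0")
            case True
            hence "a k = 0" if "k \<in> {nn i..<m}" for k using ar[OF that] by simp
            thus ?thesis using True by (simp add: centred_sum_def)
          next
            case False
            hence "\<not> 2 * r i * sqrt (4 * (L i + ln (real q + 3)))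
                \<le> cmod (centred_sum M X a {nn i..<m} (s * (real q * \<delta> i)) \<omega>)"
              using elim m s unfolding G_def by auto
            thus ?thesis unfolding \<delta>_def by simp
          qed
        qed auto
      qed
    qed
  qed
qed

end


section \<open>Deterministic convergence criteria\<close>

text \<open>Telescoping along the block endpoints from a late base index \<open>nn i0\<close>: whole
  blocks and the last incomplete one contribute at most a tail of the sum of \<rho>. Any two later
  indices are compared through this base, at a cost of \<epsilon> / 2 each.\<close>

lemma uniformly_Cauchy_of_blocks:
  fixes D :: "nat \<Rightarrow> 'p \<Rightarrow> 'b :: real_normed_vector" and w :: "'p \<Rightarrow> real"
  assumes w: "\<And>t. 0 \<le> w t" and nn: "strict_mono nn"
    and \<rho>: "\<And>i. 0 \<le> \<rho> i" "summable \<rho>"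
    and bound: "\<forall>\<^sub>F i in sequentially. \<forall>m\<in>{nn i..nn (Suc i)}. \<forall>t. norm (D m t - D (nn i) t) \<le> \<rho> i * w t"
    and "\<epsilon> > 0"
  shows "\<exists>N. \<forall>n\<ge>N. \<forall>m\<ge>n. \<forall>t. norm (D m t - D n t) \<le> \<epsilon> * w t"
proof -
  obtain i1 where i1: "norm (D m t - D (nn i) t) \<le> \<rho> i * w t"
    if "i \<ge> i1" "nn i \<le> m" "m \<le> nn (Suc i)" for i m t
    using bound unfolding eventually_sequentially by (meson atLeastAtMost_iff)
  obtain i2 where i2: "norm (sum \<rho> {m..<n}) < \<epsilon> / 2" if "m \<ge> i2" for m n
    using \<rho>(2) \<open>\<epsilon> > 0\<close> unfolding summable_Cauchy by (meson half_gt_zero)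
  define i0 where "i0 = max i1 i2"
  have *: "norm (D m t - D (nn i0) t) \<le> sum \<rho> {i0..<j} * w t"
    if "j \<ge> i0" "nn i0 \<le> m" "m \<le> nn j" for j m t
    using that
  proof (induction j arbitrary: m rule: dec_induct)
    case base
    thus ?case by simp
  next
    case (step j)
    have le: "sum \<rho> {i0..<j} * w t \<le> sum \<rho> {i0..<Suc j} * w t"
      using w \<rho> step by (intro mult_right_mono sum_mono2) auto
    show ?case
    proof (cases "m \<le> nn j")
      case True
      with step le show ?thesis by force
    next
      case False
      have "norm (D (nn j) t - D (nn i0) t) \<le> sum \<rho> {i0..<j} * w t"
        using step.hyps by (intro step.IH) (auto simp: strict_mono_less_eq[OF nn])
      moreover have "norm (D m t - D (nn j) t) \<le> \<rho> j * w t"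
        using False step by (intro i1) (auto simp: i0_def)
      ultimately have "norm (D m t - D (nn i0) t) \<le> sum \<rho> {i0..<j} * w t + \<rho> j * w t"
        using norm_triangle_ineq[of "D m t - D (nn j) t" "D (nn j) t - D (nn i0) t"] by simp
      also have "\<dots> = sum \<rho> {i0..<Suc j} * w t"
        using step.hyps by (simp add: algebra_simps)
      finally show ?thesis .
    qed
  qed
  have tail: "norm (D m t - D (nn i0) t) \<le> \<epsilon> / 2 * w t" if "m \<ge> nn i0" for m t
  proof -
    \<comment> \<open>Strict monotonicity gives \<open>j \<le> nn j\<close>, so finitely many blocks
      reach \<open>m\<close>; the maximum keeps the last block from preceding
      \<open>i0\<close>.\<close>
    have "m \<le> nn (max i0 m)"
      using seq_suble[OF nn, of "max i0 m"] by simp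
    hence "norm (D m t - D (nn i0) t) \<le> sum \<rho> {i0..<max i0 m} * w t"
      using that by (intro *) auto
    also have "\<dots> \<le> \<epsilon> / 2 * w t"
      using i2[of i0 "max i0 m"] w[of t] by (intro mult_right_mono) (auto simp: i0_def)
    finally show ?thesis .
  qed
  have "norm (D m t - D n t) \<le> \<epsilon> * w t" if "n \<ge> nn i0" "m \<ge> n" for n m t
    using norm_triangle_ineq4[of "D m t - D (nn i0) t" "D n t - D (nn i0) t"]
      tail[of m t] tail[of n t] that by simp
  thus ?thesis by blast
qed

text \<open>Abel summation with partial sums of \<open>u\<close> started at \<open>n\<close>, so
  that there is no boundary term at the lower end; the upper one carries \<open>a m\<close>, the
  first coefficient outside the range.\<close>

lemma summation_by_parts_atLeastLessThan:
  fixes a u :: "nat \<Rightarrow> 'a :: comm_ring"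
  assumes "n \<le> m"
  shows "(\<Sum>k=n..<m. a k * u k) =
     a m * (\<Sum>k=n..<m. u k) - (\<Sum>k=n..<m. (\<Sum>j=n..<Suc k. u j) * (a (Suc k) - a k))"
  using assms by (induction m rule: dec_induct) (simp_all add: algebra_simps)

text \<open>Sums of \<open>u\<close> over \<open>{n..<p}\<close> are at most \<open>2 * B\<close>,
  so the boundary term and the variation term contribute at most
  \<open>\<epsilon> / 4 * (2 * B)\<close> each. The quantifier order matters: \<open>N\<close>
  depends on \<open>a\<close> and \<epsilon> only, so one \<open>N\<close> serves all
  frequencies.\<close>

lemma uniform_tail_of_bounded_variation:
  fixes a :: "nat \<Rightarrow> complex"
  assumes "a \<longlonglongrightarrow> 0" "summable (\<lambda>k. cmod (a k - a (Suc k)))" "\<epsilon> > 0"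
  shows "\<exists>N. \<forall>u B. (\<forall>m. cmod (\<Sum>k\<le>m. u k) \<le> B) \<longrightarrow>
            (\<forall>n\<ge>N. \<forall>m\<ge>n. cmod (\<Sum>k=n..<m. a k * u k) \<le> \<epsilon> * B)"
proof -
  obtain N1 where N1: "norm (sum (\<lambda>k. cmod (a k - a (Suc k))) {n..<m}) < \<epsilon> / 4" if "n \<ge> N1" for n m
    using assms(2) \<open>\<epsilon> > 0\<close> unfolding summable_Cauchy by (metis divide_pos_pos zero_less_numeral)
  obtain N2 where N2: "cmod (a n) < \<epsilon> / 4" if "n \<ge> N2" for n
    using LIMSEQ_D[OF assms(1), of "\<epsilon> / 4"] \<open>\<epsilon> > 0\<close> by auto
  have "cmod (\<Sum>k=n..<m. a k * u k) \<le> \<epsilon> * B"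
    if B: "\<forall>m. cmod (\<Sum>k\<le>m. u k) \<le> B" and n: "n \<ge> max N1 N2" and m: "m \<ge> n" for u B n m
  proof -
    have B0: "B \<ge> 0" using B[rule_format, of 0] norm_ge_zero[of "\<Sum>k\<le>0. u k"] by linarith
    have B': "cmod (\<Sum>k<p. u k) \<le> B" for p
      using B[rule_format, of "p - 1"] B0 by (cases p) (auto simp: lessThan_Suc_atMost)
    have U: "cmod (\<Sum>k=n..<p. u k) \<le> 2 * B" if "p \<ge> n" for p
    proof -
      have "(\<Sum>k=n..<p. u k) = (\<Sum>k<p. u k) - (\<Sum>k<n. u k)"
        using sum_diff_nat_ivl[of 0 n p u] that by (simp add: atLeast0LessThan)
      thus ?thesis using norm_triangle_ineq4[of "\<Sum>k<p. u k" "\<Sum>k<n. u k"] B'[of p] B'[of n] by simp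
    qed
    have "cmod (\<Sum>k=n..<m. a k * u k) \<le> cmod (a m * (\<Sum>k=n..<m. u k))
       + cmod (\<Sum>k=n..<m. (\<Sum>j=n..<Suc k. u j) * (a (Suc k) - a k))"
      by (subst summation_by_parts_atLeastLessThan[OF m]) (rule norm_triangle_ineq4)
    also have "\<dots> \<le> \<epsilon> / 4 * (2 * B) + (\<Sum>k=n..<m. (2 * B) * cmod (a k - a (Suc k)))"
    proof (intro add_mono sum_norm_le)
      show "cmod (a m * (\<Sum>k=n..<m. u k)) \<le> \<epsilon> / 4 * (2 * B)"
        unfolding norm_mult using N2[of m] n m U[OF m] \<open>\<epsilon> > 0\<close> by (intro mult_mono) auto
    next
      fix k assume "k \<in> {n..<m}"
      thus "cmod ((\<Sum>j=n..<Suc k. u j) * (a (Suc k) - a k)) \<le> 2 * B * cmod (a k - a (Suc k))"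
        unfolding norm_mult using U[of "Suc k"] B0
        by (intro mult_mono) (auto simp: norm_minus_commute)
    qed
    also have "(\<Sum>k=n..<m. (2 * B) * cmod (a k - a (Suc k))) \<le> 2 * B * (\<epsilon> / 4)"
      unfolding sum_distrib_left[symmetric] using N1[of n m] n B0
      by (intro mult_left_mono) (auto simp: sum_nonneg)
    finally show ?thesis by (simp add: mult.commute)
  qed
  thus ?thesis by blast
qed

text \<open>Separates \<open>j\<close> from \<alpha> in the frequency
  \<open>t = j * \<alpha>\<close>. The sum of the two logarithms is at most twice their product
  because both are at least 1.\<close>

lemma ln_mult_add_3_le:
  fixes x y :: real
  shows "ln (\<bar>x * y\<bar> + 3) \<le> 2 * ln (\<bar>x\<bar> + 3) * ln (\<bar>y\<bar> + 3)"
proof -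
  define u v where "u = ln (\<bar>x\<bar> + 3)" and "v = ln (\<bar>y\<bar> + 3)"
  have "ln (\<bar>x * y\<bar> + 3) \<le> ln ((\<bar>x\<bar> + 3) * (\<bar>y\<bar> + 3))"
    by (subst ln_le_cancel_iff) (auto simp: abs_mult algebra_simps intro: add_nonneg_pos add_pos_nonneg)
  also have "\<dots> = u + v"
    unfolding u_def v_def by (rule ln_mult_pos) auto
  also have "\<dots> \<le> 2 * u * v"
  proof -
    have "u \<ge> 1" "v \<ge> 1" by (auto simp: u_def v_def one_le_ln_add_3)
    hence "u * 1 \<le> u * v" "1 * v \<le> u * v" by (auto intro!: mult_left_mono mult_right_mono)
    thus ?thesis by simp
  qed
  finally show ?thesis by (simp add: u_def v_def)
qed

section \<open>Fourier series of functions in B\<close>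

lemma exp_2_pi_i_int_eq_cis:
  "exp (2 * \<i> * of_real pi * of_real x * of_int j) = cis (2 * pi * (of_int j * x))"
  by (simp add: cis_conv_exp mult_ac)

lemma has_sum_sum:
  fixes g :: "'i \<Rightarrow> 'j \<Rightarrow> 'b :: topological_comm_monoid_add"
  assumes "\<And>i. i \<in> I \<Longrightarrow> (g i has_sum s i) A"
  shows "((\<lambda>x. \<Sum>i\<in>I. g i x) has_sum (\<Sum>i\<in>I. s i)) A"
  using assms by (induction I rule: infinite_finite_induct) (auto intro: has_sum_add)

lemma B_space_summable_on:
  assumes "f \<in> B_space"
  shows "(\<lambda>j. cmod (fourier_coeff f j)) summable_on UNIV"
proof (rule summable_on_comparison_test)
  show "(\<lambda>j. cmod (fourier_coeff f j) * sqrt (ln (real_of_int \<bar>j\<bar> + 3))) summable_on UNIV"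
    using assms by (simp add: B_space_def)
  show "cmod (fourier_coeff f j) \<le> cmod (fourier_coeff f j) * sqrt (ln (real_of_int \<bar>j\<bar> + 3))" for j
    using mult_left_mono[of 1 "sqrt (ln (real_of_int \<bar>j\<bar> + 3))" "cmod (fourier_coeff f j)"]
      one_le_ln_add_3[of "real_of_int j"] by simp
qed auto

lemma B_space_has_sum:
  assumes "f \<in> B_space"
  shows "((\<lambda>j. fourier_coeff f j * cis (2 * pi * (of_int j * x))) has_sum f x) UNIV"
  using assms unfolding B_space_def exp_2_pi_i_int_eq_cis by blast

lemma B_space_continuous_on:
  assumes "f \<in> B_space"
  shows "continuous_on S f"
proof (rule uniform_limit_theorem)
  show "uniform_limit S (\<lambda>J x. \<Sum>j\<in>J. fourier_coeff f j * cis (2 * pi * (of_int j * x))) f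
     (finite_subsets_at_top UNIV)"
    by (rule Weierstrass_m_test_general'[OF _ B_space_has_sum[OF assms] B_space_summable_on[OF assms]])
       (simp add: norm_mult)
  show "\<forall>\<^sub>F J in finite_subsets_at_top UNIV. continuous_on S
          (\<lambda>x. \<Sum>j\<in>J. fourier_coeff f j * cis (2 * pi * (of_int j * x)))"
    by (intro always_eventually allI continuous_intros continuous_on_cis)
qed simp

text \<open>The finite sum over \<open>k\<close> is exchanged with the Fourier series of
  \<open>f\<close>. The mode \<open>j = 0\<close> drops out because \<open>f\<close> has mean zero,
  so a bound for nonzero \<open>j\<close> suffices, and its growth in \<open>j\<close> is exactly
  the weight in the norm of B.\<close>

lemma B_space_sum_bound:
  fixes y :: "nat \<Rightarrow> real" and a :: "nat \<Rightarrow> complex"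
  assumes f: "f \<in> B_space" "integral {0..1} f = 0" and "finite I"
    and bound: "\<And>j::int. j \<noteq> 0 \<Longrightarrow> cmod (\<Sum>k\<in>I. a k * cis (2 * pi * (of_int j * y k)))
        \<le> \<eta> * sqrt (ln (real_of_int \<bar>j\<bar> + 3))"
  shows "cmod (\<Sum>k\<in>I. a k * f (y k))
        \<le> \<eta> * (\<Sum>\<^sub>\<infinity>j. cmod (fourier_coeff f j) * sqrt (ln (real_of_int \<bar>j\<bar> + 3)))"
proof -
  let ?c = "fourier_coeff f"
  define T where "T j = (\<Sum>k\<in>I. a k * cis (2 * pi * (of_int j * y k)))" for j :: int
  have c0: "?c 0 = 0" using f(2) by (simp add: fourier_coeff_def)
  have "((\<lambda>j. \<Sum>k\<in>I. a k * (?c j * cis (2 * pi * (of_int j * y k)))) has_sum (\<Sum>k\<in>I. a k * f (y k))) UNIV"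
    by (intro has_sum_sum has_sum_cmult_right B_space_has_sum f)
  hence 1: "((\<lambda>j. ?c j * T j) has_sum (\<Sum>k\<in>I. a k * f (y k))) UNIV"
    by (simp add: T_def sum_distrib_left mult_ac)
  have S: "(\<lambda>j. \<eta> * (cmod (?c j) * sqrt (ln (real_of_int \<bar>j\<bar> + 3)))) summable_on UNIV"
    using f(1) by (intro summable_on_cmult_right) (simp add: B_space_def)
  have le: "cmod (?c j * T j) \<le> \<eta> * (cmod (?c j) * sqrt (ln (real_of_int \<bar>j\<bar> + 3)))" for j
    using mult_left_mono[OF bound[of j], of "cmod (?c j)"]
    by (cases "j = 0") (auto simp: norm_mult c0 T_def mult_ac)
  have 2: "(\<lambda>j. cmod (?c j * T j)) summable_on UNIV"
    by (rule summable_on_comparison_test[OF S]) (use le in auto)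
  have "cmod (\<Sum>k\<in>I. a k * f (y k)) \<le> (\<Sum>\<^sub>\<infinity>j. cmod (?c j * T j))"
    by (rule norm_has_sum_bound[OF has_sum_infsum[OF 2] 1])
  also have "\<dots> \<le> (\<Sum>\<^sub>\<infinity>j. \<eta> * (cmod (?c j) * sqrt (ln (real_of_int \<bar>j\<bar> + 3))))"
    by (intro infsum_mono 2 S le)
  also have "\<dots> = \<eta> * (\<Sum>\<^sub>\<infinity>j. cmod (?c j) * sqrt (ln (real_of_int \<bar>j\<bar> + 3)))"
    by (rule infsum_cmult_right')
  finally show ?thesis .
qed

text \<open>Cauchy condensation with general weights: since \<open>h\<close> decreases, its value at
  the end of a block times the mass of \<open>w\<close> on the block is at most the block sum of
  \<open>h n * w n\<close>. This pairs \<open>h\<close> at the start of block \<open>i + 1\<close>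
  with the mass of block \<open>i\<close>, hence the shifted index in the hypothesis on
  \<open>L\<close>.\<close>

lemma summable_condensation:
  fixes h w L :: "nat \<Rightarrow> real"
  assumes h: "\<And>m n. m \<le> n \<Longrightarrow> h n \<le> h m" "\<And>n. 0 \<le> h n" and w: "\<And>n. n \<ge> 1 \<Longrightarrow> 0 \<le> w n"
    and hw: "(\<lambda>n. h n * w n) summable_on {1..}"
    and nn: "strict_mono nn" "\<And>i. nn i \<ge> 1"
    and L: "\<And>i. 0 \<le> L i" "\<And>i. L (Suc i) \<le> C * (\<Sum>n\<in>{nn i..<nn (Suc i)}. w n)"
  shows "summable (\<lambda>i. h (nn i) * L i)"
proof -
  define W where "W i = (\<Sum>n\<in>{nn i..<nn (Suc i)}. w n)" for i
  have W0: "W i \<ge> 0" for i unfolding W_def using nn(2)[of i] by (intro sum_nonneg w) auto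
  have summ: "summable (\<lambda>i. h (nn (Suc i)) * W i)"
  proof (rule bounded_imp_summable)
    show "h (nn (Suc i)) * W i \<ge> 0" for i using h W0 by simp
    fix j
    have "(\<Sum>i\<le>j. h (nn (Suc i)) * W i) \<le> (\<Sum>i\<le>j. \<Sum>n\<in>{nn i..<nn (Suc i)}. h n * w n)"
      unfolding W_def sum_distrib_left
    proof (intro sum_mono mult_right_mono h w)
      fix i n assume "n \<in> {nn i..<nn (Suc i)}"
      thus "1 \<le> n" using nn(2)[of i] by auto
    qed auto
    also have "\<dots> = (\<Sum>n\<in>{nn 0..<nn (Suc j)}. h n * w n)"
    proof (induction j)
      case (Suc j)
      have "nn 0 \<le> nn (Suc j)" "nn (Suc j) \<le> nn (Suc (Suc j))"
        using strict_mono_less_eq[OF nn(1)] by auto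
      hence "(\<Sum>n\<in>{nn 0..<nn (Suc (Suc j))}. h n * w n) =
        (\<Sum>n\<in>{nn 0..<nn (Suc j)}. h n * w n) + (\<Sum>n\<in>{nn (Suc j)..<nn (Suc (Suc j))}. h n * w n)"
        by (rule sum.atLeastLessThan_concat[symmetric])
      thus ?case using Suc by simp
    qed simp
    also have "\<dots> \<le> (\<Sum>\<^sub>\<infinity>n\<in>{1..}. h n * w n)"
    proof (rule finite_sum_le_infsum[OF hw])
      show "{nn 0..<nn (Suc j)} \<subseteq> {1..}" using nn(2)[of 0] by auto
    qed (use h w in auto)
    finally show "(\<Sum>i\<le>j. h (nn (Suc i)) * W i) \<le> (\<Sum>\<^sub>\<infinity>n\<in>{1..}. h n * w n)" .
  qed
  have "summable (\<lambda>i. h (nn (Suc i)) * L (Suc i))"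
  proof (rule summable_comparison_test'[OF summable_mult[OF summ, of C]])
    show "norm (h (nn (Suc i)) * L (Suc i)) \<le> C * (h (nn (Suc i)) * W i)" for i
      using mult_left_mono[OF L(2)[of i] h(2)[of "nn (Suc i)"]] h(2) L(1)
      by (simp add: abs_mult W_def mult_ac)
  qed
  thus ?thesis by (subst (asm) summable_Suc_iff)
qed


section \<open>Uniform convergence for a fixed outcome\<close>

text \<open>Here \<open>x k\<close> stands for the realised value of \<open>X k\<close> and \<psi>
  for the characteristic functions. At \<open>t = j * \<alpha>\<close> the centred part is small by
  hypothesis and the mean part by summation by parts, both up to a factor
  \<open>sqrt (ln (\<bar>j\<bar> + 3))\<close> and uniformly in \<alpha>; summing over
  \<open>j\<close> yields a uniform Cauchy condition.\<close>

lemma uniformly_convergent_random_series: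
  fixes x :: "nat \<Rightarrow> real" and \<psi> :: "nat \<Rightarrow> real \<Rightarrow> complex" and a :: "nat \<Rightarrow> complex"
  assumes a: "a \<longlonglongrightarrow> 0" "summable (\<lambda>k. cmod (a k - a (Suc k)))"
    and centred: "\<And>\<epsilon>. \<epsilon> > 0 \<Longrightarrow> \<exists>N. \<forall>n\<ge>N. \<forall>m\<ge>n. \<forall>t.
      cmod (\<Sum>k=n..<m. a k * (cis (2 * pi * (t * x k)) - \<psi> k t)) \<le> \<epsilon> * sqrt (ln (\<bar>t\<bar> + 3))"
    and mean: "\<And>N \<alpha> j::int. \<alpha> \<in> K \<Longrightarrow> j \<noteq> 0 \<Longrightarrow> cmod (\<Sum>k\<le>N. \<psi> k (of_int j * \<alpha>)) \<le> B"
    and f: "f \<in> B_space" "integral {0..1} f = 0" and K: "bounded K"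
  shows "uniformly_convergent_on K (\<lambda>N \<alpha>. \<Sum>k<N. a k * f (\<alpha> * x k))"
proof (intro Cauchy_uniformly_convergent uniformly_Cauchy_onI')
  fix \<epsilon> :: real assume \<epsilon>: "\<epsilon> > 0"
  obtain A where A: "\<bar>\<alpha>\<bar> \<le> A" if "\<alpha> \<in> K" for \<alpha>
    using K unfolding bounded_iff by auto
  define S where "S = (\<Sum>\<^sub>\<infinity>j. cmod (fourier_coeff f j) * sqrt (ln (real_of_int \<bar>j\<bar> + 3)))"
  have S: "S \<ge> 0"
    unfolding S_def using one_le_ln_add_3 by (intro infsum_nonneg mult_nonneg_nonneg real_sqrt_ge_zero)
      (auto intro: order_trans[OF zero_le_one])
  \<comment> \<open>\<open>E\<close> collects the constant from separating \<open>j\<close> and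
    \<alpha> and the bound for the means. Absolute values are taken since the signs of
    \<open>A\<close> and \<open>B\<close> are unknown when \<open>K\<close> is empty; the 1 in the
    denominator of \<open>e\<close> avoids division by 0 and makes the final inequality
    strict.\<close>
  define E where "E = sqrt (2 * ln (\<bar>A\<bar> + 3)) + \<bar>B\<bar>"
  have E: "E \<ge> 0" unfolding E_def using one_le_ln_add_3[of A] by simp
  define e where "e = \<epsilon> / (E * S + 1)"
  have e: "e > 0" using \<epsilon> E S by (simp add: e_def add_nonneg_pos)
  have eE: "e * E * S < \<epsilon>"
    using \<epsilon> mult_nonneg_nonneg[OF E S] by (simp add: e_def field_simps add_pos_nonneg)
  obtain N1 where N1: "cmod (\<Sum>k=n..<m. a k * (cis (2 * pi * (t * x k)) - \<psi> k t)) \<le> e * sqrt (ln (\<bar>t\<bar> + 3))"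
    if "n \<ge> N1" "m \<ge> n" for n m t
    using centred[OF e] by blast
  obtain N2 where N2: "cmod (\<Sum>k=n..<m. a k * u k) \<le> e * B'"
    if "n \<ge> N2" "m \<ge> n" "\<And>m. cmod (\<Sum>k\<le>m. u k) \<le> B'" for n m u B'
    using uniform_tail_of_bounded_variation[OF a e] by blast
  have "dist (\<Sum>k<n. a k * f (\<alpha> * x k)) (\<Sum>k<m. a k * f (\<alpha> * x k)) < \<epsilon>"
    if \<alpha>: "\<alpha> \<in> K" and n: "n \<ge> max N1 N2" and m: "m > n" for \<alpha> n m
  proof -
    have "cmod (\<Sum>k=n..<m. a k * f (\<alpha> * x k)) \<le> (e * E) * S"
      unfolding S_def
    proof (rule B_space_sum_bound[OF f])
      fix j :: int assume j: "j \<noteq> 0"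
      let ?t = "of_int j * \<alpha>" and ?l = "sqrt (ln (real_of_int \<bar>j\<bar> + 3))"
      have l: "1 \<le> ?l" using one_le_ln_add_3[of "of_int j"] by simp
      have "ln (\<bar>?t\<bar> + 3) \<le> 2 * ln (\<bar>of_int j\<bar> + 3) * ln (\<bar>\<alpha>\<bar> + 3)"
        by (rule ln_mult_add_3_le)
      also have "\<dots> \<le> 2 * ln (\<bar>of_int j\<bar> + 3) * ln (\<bar>A\<bar> + 3)"
        using A[OF \<alpha>] one_le_ln_add_3[of "of_int j"] by (intro mult_left_mono) auto
      finally have "sqrt (ln (\<bar>?t\<bar> + 3)) \<le> sqrt (2 * ln (\<bar>A\<bar> + 3)) * ?l"
        by (simp add: mult_ac flip: real_sqrt_mult)
      hence "e * sqrt (ln (\<bar>?t\<bar> + 3)) \<le> e * (sqrt (2 * ln (\<bar>A\<bar> + 3)) * ?l)"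
        using e by (intro mult_left_mono) auto
      with N1[of n m ?t] n m have 1: "cmod (\<Sum>k=n..<m. a k * (cis (2 * pi * (?t * x k)) - \<psi> k ?t))
          \<le> e * (sqrt (2 * ln (\<bar>A\<bar> + 3)) * ?l)" by simp
      have "cmod (\<Sum>k=n..<m. a k * \<psi> k ?t) \<le> e * B"
        using n m by (intro N2 mean[OF \<alpha> j]) auto
      also have "\<dots> \<le> e * (\<bar>B\<bar> * ?l)"
        using e l mult_left_mono[OF l, of "\<bar>B\<bar>"] by (intro mult_left_mono) auto
      finally have 2: "cmod (\<Sum>k=n..<m. a k * \<psi> k ?t) \<le> e * (\<bar>B\<bar> * ?l)" .
      have eq: "(\<Sum>k=n..<m. a k * cis (2 * pi * (of_int j * (\<alpha> * x k)))) =
        (\<Sum>k=n..<m. a k * (cis (2 * pi * (?t * x k)) - \<psi> k ?t)) + (\<Sum>k=n..<m. a k * \<psi> k ?t)"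
        by (simp add: algebra_simps flip: sum.distrib)
      have "cmod (\<Sum>k=n..<m. a k * cis (2 * pi * (of_int j * (\<alpha> * x k)))) \<le>
        e * (sqrt (2 * ln (\<bar>A\<bar> + 3)) * ?l) + e * (\<bar>B\<bar> * ?l)"
        unfolding eq by (rule norm_triangle_mono[OF 1 2])
      thus "cmod (\<Sum>k=n..<m. a k * cis (2 * pi * (of_int j * (\<alpha> * x k)))) \<le> e * E * ?l"
        by (simp add: E_def algebra_simps)
    qed auto
    hence "cmod (\<Sum>k=n..<m. a k * f (\<alpha> * x k)) < \<epsilon>" using eE by simp
    moreover have "(\<Sum>k<m. a k * f (\<alpha> * x k)) - (\<Sum>k<n. a k * f (\<alpha> * x k)) = (\<Sum>k=n..<m. a k * f (\<alpha> * x k))"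
      using sum_diff_nat_ivl[of 0 n m] m by (simp add: atLeast0LessThan)
    ultimately show ?thesis by (simp add: dist_norm norm_minus_commute)
  qed
  thus "\<exists>N. \<forall>\<alpha>\<in>K. \<forall>n\<ge>N. \<forall>m>n.
      dist (\<Sum>k<n. a k * f (\<alpha> * x k)) (\<Sum>k<m. a k * f (\<alpha> * x k)) < \<epsilon>" by blast
qed

text \<open>Telescoping of ln (1 + 1/n) \<le> 1/n; it bounds the harmonic mass of a block from
  below.\<close>

lemma sum_inverse_ge_ln_diff:
  fixes m n :: nat
  assumes "1 \<le> m" "m \<le> n"
  shows "ln (real n) - ln (real m) \<le> (\<Sum>k=m..<n. 1 / real k)"
  using assms(2)
proof (induction n rule: dec_induct)
  case base
  thus ?case by simp
next
  case (step n)
  have n: "real n > 0" using step assms(1) by simp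
  have "ln (real (Suc n)) - ln (real n) = ln (1 + 1 / real n)"
    using n by (subst ln_divide_pos[symmetric]) (simp_all add: field_simps)
  also have "\<dots> \<le> 1 / real n" using n by (intro ln_add_one_self_le_self) auto
  finally show ?case using step by simp
qed

section \<open>Moment hypotheses and the choice of blocks\<close>

context prob_space
begin

text \<open>The Hoelder estimate requires an exponent at most 1, so \<beta> is lowered to
  \<open>min \<beta> 1\<close> at the price of an additive 1, by \<open>\<bar>y\<bar> powr min
  \<beta> 1 \<le> 1 + \<bar>y\<bar> powr \<beta>\<close>.\<close>

lemma moments_bigo_small_exponent:
  assumes X: "\<And>k. X k \<in> borel_measurable M" and "moments_bigo M X \<beta> g" and \<beta>: "\<beta> > 0"
    and g: "\<And>k. 0 \<le> g k"
  obtains C N where "C \<ge> 0" "\<And>k. k \<ge> N \<Longrightarrow> integrable M (\<lambda>\<omega>. \<bar>X k \<omega>\<bar> powr min \<beta> 1)"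
    "\<And>k. k \<ge> N \<Longrightarrow> expectation (\<lambda>\<omega>. \<bar>X k \<omega>\<bar> powr min \<beta> 1) \<le> 1 + C * g k"
proof -
  note [measurable] = X
  obtain C where C: "C > 0"
    "\<forall>\<^sub>F k in sequentially. norm (expectation (\<lambda>\<omega>. \<bar>X k \<omega>\<bar> powr \<beta>)) \<le> C * norm (g k)"
    using assms(2) unfolding moments_bigo_def by (elim conjE landau_o.bigE)
  have "\<forall>\<^sub>F k in sequentially. integrable M (\<lambda>\<omega>. \<bar>X k \<omega>\<bar> powr \<beta>) \<and>
     expectation (\<lambda>\<omega>. \<bar>X k \<omega>\<bar> powr \<beta>) \<le> C * g k"
    using C(2) assms(2) g unfolding moments_bigo_def by (auto elim: eventually_elim2)
  then obtain N where N: "integrable M (\<lambda>\<omega>. \<bar>X k \<omega>\<bar> powr \<beta>)"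
     "expectation (\<lambda>\<omega>. \<bar>X k \<omega>\<bar> powr \<beta>) \<le> C * g k" if "k \<ge> N" for k
    unfolding eventually_sequentially by blast
  have le: "\<bar>y\<bar> powr min \<beta> 1 \<le> 1 + \<bar>y\<bar> powr \<beta>" for y :: real
  proof (cases "\<bar>y\<bar> \<le> 1")
    case True
    hence "\<bar>y\<bar> powr min \<beta> 1 \<le> 1" using \<beta> by (intro powr_le1) auto
    thus ?thesis by (simp add: add_increasing2)
  next
    case False
    hence "\<bar>y\<bar> powr min \<beta> 1 \<le> \<bar>y\<bar> powr \<beta>" by (intro powr_mono) auto
    thus ?thesis by simp
  qed
  have int: "integrable M (\<lambda>\<omega>. \<bar>X k \<omega>\<bar> powr min \<beta> 1)" if "k \<ge> N" for k
    by (rule Bochner_Integration.integrable_bound[of M "\<lambda>\<omega>. 1 + \<bar>X k \<omega>\<bar> powr \<beta>"])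
       (use N[OF that] le in \<open>auto simp: abs_of_nonneg add_nonneg_nonneg\<close>)
  have "expectation (\<lambda>\<omega>. \<bar>X k \<omega>\<bar> powr min \<beta> 1) \<le> 1 + C * g k" if "k \<ge> N" for k
  proof -
    have "expectation (\<lambda>\<omega>. \<bar>X k \<omega>\<bar> powr min \<beta> 1) \<le> expectation (\<lambda>\<omega>. 1 + \<bar>X k \<omega>\<bar> powr \<beta>)"
      using int[OF that] N[OF that] le by (intro integral_mono) auto
    also have "\<dots> = 1 + expectation (\<lambda>\<omega>. \<bar>X k \<omega>\<bar> powr \<beta>)"
      using N[OF that] by (simp add: prob_space)
    finally show ?thesis using N[OF that] by simp
  qed
  with int C(1) show ?thesis by (intro that[of C N]) auto
qed

text \<open>\<open>L i\<close> is the logarithmic budget of block \<open>i\<close>: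
  \<open>exp (L i)\<close> dominates its indices and moments, and growth at least linear makes
  \<open>exp (- L i)\<close> summable. The function \<open>h\<close> will be the l2 norm of the tail
  of \<open>a\<close>.\<close>

definition admissible_blocks ::
  "(nat \<Rightarrow> 'a \<Rightarrow> real) \<Rightarrow> (nat \<Rightarrow> real) \<Rightarrow> real \<Rightarrow> (nat \<Rightarrow> nat) \<Rightarrow> (nat \<Rightarrow> real) \<Rightarrow> bool" where
  "admissible_blocks X h b nn L \<longleftrightarrow> 0 < b \<and> b \<le> 1 \<and> strict_mono nn \<and>
     (\<forall>i. real i + 1 \<le> L i \<and> real (nn (Suc i)) \<le> exp (L i)) \<and>
     (\<forall>i. \<forall>k\<in>{nn i..<nn (Suc i)}. integrable M (\<lambda>\<omega>. \<bar>X k \<omega>\<bar> powr b) \<and>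
        expectation (\<lambda>\<omega>. \<bar>X k \<omega>\<bar> powr b) \<le> exp (L i)) \<and>
     summable (\<lambda>i. h (nn i) * sqrt (L i))"

text \<open>Condensation with weights \<open>1 / (real n * c n)\<close> gives the summability. The
  first \<open>N\<close> blocks are discarded so that every remaining index is at least
  \<open>N\<close>, where the moment bounds hold; \<open>1 + C * g k \<le> exp C * g k\<close> puts
  these in exponential form.\<close>

lemma admissible_blocksI:
  assumes b: "0 < b" "b \<le> 1" and nn: "strict_mono nn" "\<And>i. 1 \<le> nn i"
    and L: "\<And>i. real i + 1 \<le> L i" "\<And>i. real (nn (Suc i)) \<le> exp (L i)"
    and int: "\<And>k. k \<ge> N \<Longrightarrow> integrable M (\<lambda>\<omega>. \<bar>X k \<omega>\<bar> powr b)"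
    and mom: "\<And>k. k \<ge> N \<Longrightarrow> expectation (\<lambda>\<omega>. \<bar>X k \<omega>\<bar> powr b) \<le> 1 + C * g k" "C \<ge> 0"
    and g: "\<And>i k. nn i \<le> k \<Longrightarrow> k < nn (Suc i) \<Longrightarrow> 1 \<le> g k \<and> exp C * g k \<le> exp (L i)"
    and h: "\<And>m n. m \<le> n \<Longrightarrow> h n \<le> h m" "\<And>n. 0 \<le> h n" and c: "\<And>n. n \<ge> 1 \<Longrightarrow> 0 \<le> c n"
    and hc: "(\<lambda>n. h n / (real n * c n)) summable_on {1..}"
    and Lc: "\<And>i. sqrt (L (Suc i)) \<le> D * (\<Sum>n=nn i..<nn (Suc i). 1 / (real n * c n))"
  shows "\<exists>b nn L. admissible_blocks X h b nn L"
proof -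
  have "summable (\<lambda>i. h (nn i) * sqrt (L i))"
  proof (rule summable_condensation[OF h _ _ nn _ Lc])
    show "0 \<le> 1 / (real n * c n)" if "n \<ge> 1" for n using c[OF that] by simp
    show "(\<lambda>n. h n * (1 / (real n * c n))) summable_on {1..}" using hc by simp
    show "0 \<le> sqrt (L i)" for i using L(1)[of i] by simp
  qed
  hence sm: "summable (\<lambda>i. h (nn (i + N)) * sqrt (L (i + N)))"
    by (subst summable_iff_shift)
  have "admissible_blocks X h b (\<lambda>i. nn (i + N)) (\<lambda>i. L (i + N))"
    unfolding admissible_blocks_def
  proof (intro conjI allI ballI b sm)
    show "strict_mono (\<lambda>i. nn (i + N))" using nn(1) by (simp add: strict_mono_def)
    show "real i + 1 \<le> L (i + N)" for i using L(1)[of "i + N"] by simp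
    show "real (nn (Suc i + N)) \<le> exp (L (i + N))" for i using L(2)[of "i + N"] by simp
  next
    fix i k assume k: "k \<in> {nn (i + N)..<nn (Suc i + N)}"
    have "N \<le> k" using seq_suble[OF nn(1), of "i + N"] k by simp
    show "integrable M (\<lambda>\<omega>. \<bar>X k \<omega>\<bar> powr b)" by (rule int) fact
    have gk: "1 \<le> g k" "exp C * g k \<le> exp (L (i + N))" using g[of "i + N" k] k by auto
    have "expectation (\<lambda>\<omega>. \<bar>X k \<omega>\<bar> powr b) \<le> 1 + C * g k" by (rule mom) fact
    also have "\<dots> \<le> (1 + C) * g k" using gk by (simp add: distrib_right)
    also have "\<dots> \<le> exp C * g k" using gk by (intro mult_right_mono exp_ge_add_one_self) auto
    finally show "expectation (\<lambda>\<omega>. \<bar>X k \<omega>\<bar> powr b) \<le> exp (L (i + N))" using gk by simp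
  qed
  thus ?thesis by blast
qed

text \<open>On the block from \<open>2 ^ 2 ^ i\<close> to \<open>2 ^ 2 ^ (i + 1)\<close> the
  harmonic mass is of order \<open>2 ^ i\<close> while \<open>c n\<close> is at most of order
  \<open>sqrt (2 ^ i)\<close>. The mass of \<open>1 / (n * c n)\<close> is therefore at least of
  order \<open>sqrt (2 ^ i)\<close>, as is \<open>sqrt (L (Suc i))\<close>.\<close>

lemma admissible_blocks_polynomial:
  assumes X: "\<And>k. X k \<in> borel_measurable M" and moments: "polynomial_case M X c"
    and h: "\<And>m n. m \<le> n \<Longrightarrow> h n \<le> h m" "\<And>n. 0 \<le> h n"
    and hc: "(\<lambda>n. h n / (real n * c n)) summable_on {1..}"
  shows "\<exists>b nn L. admissible_blocks X h b nn L"
proof -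
  obtain \<beta> d where \<beta>: "\<beta> > 0" and d: "d > 0" and mom: "moments_bigo M X \<beta> (\<lambda>k. real k powr d)"
    and c: "\<And>n. n \<ge> 1 \<Longrightarrow> c n = 1 + sqrt (ln (real n))"
    using moments unfolding polynomial_case_def by blast
  obtain C N where C: "C \<ge> 0" "\<And>k. k \<ge> N \<Longrightarrow> integrable M (\<lambda>\<omega>. \<bar>X k \<omega>\<bar> powr min \<beta> 1)"
    "\<And>k. k \<ge> N \<Longrightarrow> expectation (\<lambda>\<omega>. \<bar>X k \<omega>\<bar> powr min \<beta> 1) \<le> 1 + C * real k powr d"
    by (rule moments_bigo_small_exponent[OF X mom \<beta>]) auto
  \<comment> \<open>The 2 lets \<open>L i\<close> dominate ln (nn (Suc i)) \<le> 2 * 2 ^ i; the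
    terms \<open>C\<close> and \<open>2 * d\<close> absorb \<open>exp C\<close> and
    \<open>k powr d\<close>.\<close>
  define \<kappa> where "\<kappa> = 2 + C + 2 * d"
  define nn :: "nat \<Rightarrow> nat" where "nn i = 2 ^ (2 ^ i)" for i
  define L :: "nat \<Rightarrow> real" where "L i = \<kappa> * 2 ^ i" for i
  have ln2: "ln 2 \<le> (1 :: real)" "1 / 2 \<le> ln (2 :: real)"
    using ln_le_minus_one[of "2 :: real"] ln_le_minus_one[of "1 / 2 :: real"] by (auto simp: ln_div)
  have lnn: "ln (real (nn i)) = 2 ^ i * ln 2" for i
    by (simp add: nn_def ln_realpow)
  have i1: "real i + 1 \<le> 2 ^ i" for i
    using of_nat_mono[OF Suc_leI[OF less_exp[of i]], where 'a = real] by simp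
  have pow1: "1 \<le> (2 :: real) ^ i" for i by simp
  have nn1: "1 \<le> nn i" for i by (simp add: nn_def)
  show ?thesis
  proof (rule admissible_blocksI[where b = "min \<beta> 1" and nn = nn and L = L and X = X and g = "\<lambda>k. real k powr d",
        OF _ _ _ nn1 _ _ C(2) C(3) C(1) _ h _ hc])
    show "strict_mono nn" by (simp add: strict_mono_def nn_def)
    show "real i + 1 \<le> L i" for i
    proof -
      have "1 * 2 ^ i \<le> \<kappa> * 2 ^ i" using C d by (intro mult_right_mono) (auto simp: \<kappa>_def)
      with i1[of i] show ?thesis unfolding L_def by linarith
    qed
    have nn_le: "ln (real (nn (Suc i))) \<le> 2 * 2 ^ i" for i
      using mult_left_mono[OF ln2(1), of "2 * 2 ^ i"] by (simp add: lnn)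
    show "real (nn (Suc i)) \<le> exp (L i)" for i
    proof -
      have "2 * 2 ^ i \<le> L i"
        unfolding L_def using C d by (intro mult_right_mono) (auto simp: \<kappa>_def)
      with nn_le[of i] have "ln (real (nn (Suc i))) \<le> L i" by linarith
      hence "exp (ln (real (nn (Suc i)))) \<le> exp (L i)" by simp
      thus ?thesis by (simp add: nn_def)
    qed
    show "1 \<le> real k powr d \<and> exp C * real k powr d \<le> exp (L i)"
      if k: "nn i \<le> k" "k < nn (Suc i)" for i k
    proof
      have k1: "1 \<le> real k" using nn1[of i] k by simp
      thus "1 \<le> real k powr d" using d by (intro ge_one_powr_ge_zero) auto
      have "ln (real k) \<le> ln (real (nn (Suc i)))" using k k1 by simp
      hence "d * ln (real k) \<le> d * (2 * 2 ^ i)" using nn_le[of i] d by (intro mult_left_mono) auto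
      moreover have "C * 1 \<le> C * 2 ^ i" by (intro mult_left_mono C pow1)
      moreover have "L i = 2 * 2 ^ i + C * 2 ^ i + d * (2 * 2 ^ i)"
        by (simp add: L_def \<kappa>_def algebra_simps)
      moreover have "0 \<le> (2 :: real) * 2 ^ i" by simp
      ultimately have "C + d * ln (real k) \<le> L i" by linarith
      hence "exp (C + d * ln (real k)) \<le> exp (L i)" by simp
      thus "exp C * real k powr d \<le> exp (L i)" using k1 by (simp add: exp_add powr_def)
    qed
    show "0 \<le> c n" if "n \<ge> 1" for n using that by (simp add: c)
    show "sqrt (L (Suc i)) \<le> (8 * sqrt \<kappa>) * (\<Sum>n=nn i..<nn (Suc i). 1 / (real n * c n))" for i
    proof -
      \<comment> \<open>\<open>x\<close> is both the logarithm of \<open>nn i\<close> and the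
        increase of the logarithm over the block, so the logarithm at the end of the block is
        \<open>2 * x\<close>.\<close>
      define x where "x = 2 ^ i * ln (2::real)"
      have "(1 / 2 :: real) * 2 ^ i \<le> x" unfolding x_def using ln2 by (simp add: mult.commute)
      hence x: "2 ^ i \<le> 2 * x" by simp
      hence x2: "1 \<le> 2 * x" using pow1[of i] by linarith
      hence x0: "x > 0" by simp
      have "L (Suc i) \<le> \<kappa> * (4 * x)"
        unfolding L_def using x C d by (intro mult_left_mono) (auto simp: \<kappa>_def)
      hence "sqrt (L (Suc i)) \<le> sqrt (\<kappa> * (4 * x))" by simp
      also have "\<dots> = 2 * sqrt \<kappa> * sqrt x" by (simp add: real_sqrt_mult)
      also have "\<dots> = 8 * sqrt \<kappa> * (sqrt x / 4)" by simp
      also have "sqrt x / 4 \<le> x / (1 + sqrt (2 * x))"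
      proof -
        have "1 \<le> sqrt (2 * x)" using x2 by simp
        moreover have "sqrt (2 * x) \<le> sqrt (4 * x)" using x0 by simp
        hence "sqrt (2 * x) \<le> 2 * sqrt x" by (simp add: real_sqrt_mult)
        ultimately have "1 + sqrt (2 * x) \<le> 4 * sqrt x" by linarith
        hence "sqrt x * (1 + sqrt (2 * x)) \<le> sqrt x * (4 * sqrt x)" using x0 by (intro mult_left_mono) auto
        also have "\<dots> = 4 * x" using x0 by simp
        finally show ?thesis using x0 by (simp add: field_simps add_pos_nonneg)
      qed
      also have "x / (1 + sqrt (2 * x)) = (ln (real (nn (Suc i))) - ln (real (nn i))) / (1 + sqrt (2 * x))"
        by (simp add: lnn x_def)
      also have "\<dots> \<le> (\<Sum>n=nn i..<nn (Suc i). 1 / real n) / (1 + sqrt (2 * x))"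
        using x0 by (intro divide_right_mono sum_inverse_ge_ln_diff nn1) (auto simp: nn_def intro!: power_increasing)
      also have "\<dots> = (\<Sum>n=nn i..<nn (Suc i). 1 / real n / (1 + sqrt (2 * x)))"
        by (rule sum_divide_distrib)
      also have "\<dots> \<le> (\<Sum>n=nn i..<nn (Suc i). 1 / (real n * c n))"
      proof (rule sum_mono)
        fix n assume n: "n \<in> {nn i..<nn (Suc i)}"
        hence n1: "n \<ge> 1" using nn1[of i] by auto
        have "ln (real n) \<le> ln (real (nn (Suc i)))" using n n1 by simp
        hence "c n \<le> 1 + sqrt (2 * x)" using n1 by (simp add: c lnn x_def)
        moreover have "c n > 0" using n1 by (simp add: c add_pos_nonneg)
        ultimately show "1 / real n / (1 + sqrt (2 * x)) \<le> 1 / (real n * c n)"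
          using n1 x0 by (simp add: frac_le)
      qed
      finally show ?thesis using C d by (simp add: \<kappa>_def mult_left_mono)
    qed
  qed (use \<beta> in auto)
qed

text \<open>Here \<open>1 / (n * c n) = n powr (\<gamma> / 2 - 1)\<close> is decreasing. With
  \<open>m = 2 ^ (i + 1)\<close>, the \<open>m / 2\<close> terms of a dyadic block add up to at
  least \<open>m powr (\<gamma> / 2) / 2\<close>, the order of
  \<open>sqrt (L (Suc i))\<close>.\<close>

lemma admissible_blocks_subexponential:
  assumes X: "\<And>k. X k \<in> borel_measurable M" and moments: "subexponential_case M X c"
    and h: "\<And>m n. m \<le> n \<Longrightarrow> h n \<le> h m" "\<And>n. 0 \<le> h n"
    and hc: "(\<lambda>n. h n / (real n * c n)) summable_on {1..}"
  shows "\<exists>b nn L. admissible_blocks X h b nn L"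
proof -
  obtain \<beta> \<gamma> where \<beta>: "\<beta> > 0" and \<gamma>: "0 < \<gamma>" "\<gamma> < 1"
    and mom: "moments_bigo M X \<beta> (\<lambda>k. 2 powr (real k powr \<gamma>))"
    and c: "\<And>n. n \<ge> 1 \<Longrightarrow> c n = real n powr (- \<gamma> / 2)"
    using moments unfolding subexponential_case_def by blast
  obtain C N where C: "C \<ge> 0" "\<And>k. k \<ge> N \<Longrightarrow> integrable M (\<lambda>\<omega>. \<bar>X k \<omega>\<bar> powr min \<beta> 1)"
    "\<And>k. k \<ge> N \<Longrightarrow> expectation (\<lambda>\<omega>. \<bar>X k \<omega>\<bar> powr min \<beta> 1) \<le> 1 + C * 2 powr (real k powr \<gamma>)"
    by (rule moments_bigo_small_exponent[OF X mom \<beta>]) auto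
  \<comment> \<open>The summand 2 covers doubling of the index, which at most doubles
    \<open>n powr \<gamma>\<close>; \<open>C\<close> absorbs \<open>exp C\<close>;
    \<open>2 / \<gamma>\<close> yields \<open>L i \<ge> i + 1\<close>, as
    \<open>2 powr (\<gamma> * i)\<close> grows at least linearly.\<close>
  define \<kappa> where "\<kappa> = 2 + C + 2 / \<gamma>"
  define nn :: "nat \<Rightarrow> nat" where "nn i = 2 ^ i" for i
  define L :: "nat \<Rightarrow> real" where "L i = \<kappa> * real (nn i) powr \<gamma>" for i
  have ln2: "ln 2 \<le> (1 :: real)" "1 / 2 \<le> ln (2 :: real)"
    using ln_le_minus_one[of "2 :: real"] ln_le_minus_one[of "1 / 2 :: real"] by (auto simp: ln_div)
  have nn1: "1 \<le> nn i" for i by (simp add: nn_def)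
  have pow1: "1 \<le> real (nn i) powr \<gamma>" for i
    using nn1[of i] \<gamma> by (intro ge_one_powr_ge_zero) auto
  have L_ge: "real i + 1 \<le> L i" for i
  proof -
    have "(\<gamma> / 2) * (real i + 1) \<le> 1 + \<gamma> * (real i * (1 / 2))" using \<gamma> by (simp add: field_simps)
    also have "\<dots> \<le> 1 + \<gamma> * (real i * ln 2)"
      using \<gamma> ln2 by (intro add_left_mono mult_left_mono) auto
    also have "\<dots> \<le> exp (\<gamma> * (real i * ln 2))" by (rule exp_ge_add_one_self)
    also have "\<dots> = real (nn i) powr \<gamma>" by (simp add: powr_def nn_def ln_realpow)
    finally have "real i + 1 \<le> 2 / \<gamma> * real (nn i) powr \<gamma>" using \<gamma> by (simp add: field_simps)
    also have "\<dots> \<le> L i" unfolding L_def using C by (intro mult_right_mono) (auto simp: \<kappa>_def)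
    finally show ?thesis .
  qed
  have step: "real (nn (Suc i)) powr \<gamma> \<le> 2 * real (nn i) powr \<gamma>" for i
  proof -
    have "2 powr \<gamma> \<le> 2 powr 1" using \<gamma> by (intro powr_mono) auto
    thus ?thesis by (simp add: nn_def powr_mult)
  qed
  show ?thesis
  proof (rule admissible_blocksI[where b = "min \<beta> 1" and nn = nn and L = L and X = X
        and g = "\<lambda>k. 2 powr (real k powr \<gamma>)", OF _ _ _ nn1 L_ge _ C(2) C(3) C(1) _ h _ hc])
    show "strict_mono nn" by (simp add: strict_mono_def nn_def)
    show "real (nn (Suc i)) \<le> exp (L i)" for i
    proof -
      have "real (nn (Suc i)) = exp (real (Suc i) * ln 2)"
        unfolding exp_of_nat_mult by (simp add: nn_def)
      also have "\<dots> \<le> exp (real i + 1)"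
        using mult_left_mono[OF ln2(1), of "real (Suc i)"] by (simp add: add.commute)
      also have "\<dots> \<le> exp (L i)" using L_ge by simp
      finally show ?thesis .
    qed
    show "1 \<le> 2 powr (real k powr \<gamma>) \<and> exp C * 2 powr (real k powr \<gamma>) \<le> exp (L i)"
      if k: "nn i \<le> k" "k < nn (Suc i)" for i k
    proof
      show "1 \<le> (2 :: real) powr (real k powr \<gamma>)" by (intro ge_one_powr_ge_zero) auto
      have "real k powr \<gamma> \<le> real (nn (Suc i)) powr \<gamma>"
        using k \<gamma> by (intro powr_mono2) auto
      hence "real k powr \<gamma> \<le> 2 * real (nn i) powr \<gamma>" using step[of i] by simp
      moreover have "real k powr \<gamma> * ln 2 \<le> real k powr \<gamma> * 1"
        using ln2 by (intro mult_left_mono) auto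
      moreover have "C * 1 \<le> C * real (nn i) powr \<gamma>" by (intro mult_left_mono C pow1)
      moreover have "0 \<le> 2 / \<gamma> * real (nn i) powr \<gamma>" using \<gamma> by simp
      ultimately have "C + real k powr \<gamma> * ln 2 \<le> L i"
        unfolding L_def \<kappa>_def distrib_right by linarith
      hence "exp (C + real k powr \<gamma> * ln 2) \<le> exp (L i)" by simp
      thus "exp C * 2 powr (real k powr \<gamma>) \<le> exp (L i)" by (simp add: exp_add powr_def)
    qed
    show "0 \<le> c n" if "n \<ge> 1" for n using that by (simp add: c)
    show "sqrt (L (Suc i)) \<le> (2 * sqrt \<kappa>) * (\<Sum>n=nn i..<nn (Suc i). 1 / (real n * c n))" for i
    proof -
      let ?m = "real (nn (Suc i))"
      have m: "?m > 0" by (simp add: nn_def)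
      have "sqrt (L (Suc i)) = sqrt \<kappa> * ?m powr (\<gamma> / 2)"
        by (simp add: L_def real_sqrt_mult powr_half_sqrt[symmetric] powr_powr)
      also have "?m powr (\<gamma> / 2) = 2 * (real (card {nn i..<nn (Suc i)}) * (?m powr (\<gamma> / 2) / ?m))"
        by (simp add: nn_def)
      also have "real (card {nn i..<nn (Suc i)}) * (?m powr (\<gamma> / 2) / ?m)
          \<le> (\<Sum>n=nn i..<nn (Suc i). 1 / (real n * c n))"
      proof (rule sum_bounded_below)
        fix n assume n: "n \<in> {nn i..<nn (Suc i)}"
        hence n1: "n \<ge> 1" using nn1[of i] by auto
        have "?m powr (\<gamma> / 2) / ?m = ?m powr (\<gamma> / 2 - 1)" using m by (simp add: powr_diff)
        also have "\<dots> \<le> real n powr (\<gamma> / 2 - 1)" using n n1 \<gamma> by (intro powr_mono2') auto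
        also have "\<dots> = real n powr (\<gamma> / 2) / real n" using n1 by (simp add: powr_diff)
        also have "\<dots> = 1 / (real n * c n)"
          using n1 by (simp add: c powr_minus_divide flip: minus_divide_left)
        finally show "?m powr (\<gamma> / 2) / ?m \<le> 1 / (real n * c n)" .
      qed
      finally show ?thesis using C \<gamma> by (simp add: \<kappa>_def mult_left_mono)
    qed
  qed (use \<beta> in auto)
qed

section \<open>Bounded means and the almost sure Cauchy property\<close>

lemma cmod_phi_le_1: "cmod (phi M Y t) \<le> 1"
proof -
  have "cmod (phi M Y t) \<le> expectation (\<lambda>\<omega>. cmod (cis (2 * pi * (t * Y \<omega>))))"
    unfolding phi_eq_integral_cis by (rule integral_norm_bound)
  thus ?thesis by (simp add: prob_space)
qed

text \<open>Turns the finite extended supremum into a real bound. The supremum starts at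
  \<open>N = 1\<close>; the missing case \<open>N = 0\<close> is a single characteristic function,
  of modulus at most 1.\<close>

lemma phi_sums_bounded:
  assumes fin: "(SUP N\<in>{1::nat..}. SUP \<alpha>\<in>K. SUP j\<in>UNIV - {0::int}.
              ennreal (cmod (\<Sum>k=0..N. phi M (X k) (of_int j * \<alpha>)))) < \<infinity>"
  obtains B where "\<And>N \<alpha> j::int. \<alpha> \<in> K \<Longrightarrow> j \<noteq> 0 \<Longrightarrow> cmod (\<Sum>k\<le>N. phi M (X k) (of_int j * \<alpha>)) \<le> B"
proof -
  define U where "U = (SUP N\<in>{1::nat..}. SUP \<alpha>\<in>K. SUP j\<in>UNIV - {0::int}.
              ennreal (cmod (\<Sum>k=0..N. phi M (X k) (of_int j * \<alpha>))))"
  have "cmod (\<Sum>k\<le>N. phi M (X k) (of_int j * \<alpha>)) \<le> max 1 (enn2real U)"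
    if \<alpha>: "\<alpha> \<in> K" and j: "j \<noteq> 0" for N \<alpha> and j :: int
  proof (cases "N = 0")
    case True
    thus ?thesis using cmod_phi_le_1[of "X 0" "of_int j * \<alpha>"] by simp
  next
    case False
    have "ennreal (cmod (\<Sum>k=0..N. phi M (X k) (of_int j * \<alpha>))) \<le> U"
      unfolding U_def using False \<alpha> j
      by (intro SUP_upper2[of N] SUP_upper2[of \<alpha>] SUP_upper2[of j]) auto
    hence "cmod (\<Sum>k=0..N. phi M (X k) (of_int j * \<alpha>)) \<le> enn2real U"
      using fin enn2real_mono[of "ennreal (cmod (\<Sum>k=0..N. phi M (X k) (of_int j * \<alpha>)))" U]
      unfolding U_def by simp
    thus ?thesis by (simp add: atLeast0AtMost)
  qed
  thus ?thesis by (rule that)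
qed

text \<open>The block estimate is fed into the telescoping criterion with increments proportional to
  \<open>r i * sqrt (L i)\<close>. The exceptional null set serves all real \<open>t\<close>
  simultaneously.\<close>

lemma AE_centred_sum_uniformly_Cauchy:
  fixes X :: "nat \<Rightarrow> 'a \<Rightarrow> real" and a :: "nat \<Rightarrow> complex"
  assumes indep: "indep_vars (\<lambda>_. borel) X UNIV" and a: "summable (\<lambda>k. (cmod (a k))\<^sup>2)"
    and blocks: "admissible_blocks X (\<lambda>n. sqrt (\<Sum>\<^sub>\<infinity>k\<in>{n..}. (cmod (a k))\<^sup>2)) b nn L"
  shows "AE \<omega> in M. \<forall>\<epsilon>>0. \<exists>N. \<forall>n\<ge>N. \<forall>m\<ge>n. \<forall>t.
     cmod (centred_sum M X a {n..<m} t \<omega>) \<le> \<epsilon> * sqrt (ln (\<bar>t\<bar> + 3))"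
proof -
  define r where "r i = sqrt (\<Sum>\<^sub>\<infinity>k\<in>{nn i..}. (cmod (a k))\<^sup>2)" for i
  have b: "0 < b" "b \<le> 1" and nn: "strict_mono nn"
    and L: "\<And>i. real i + 1 \<le> L i" "\<And>i. real (nn (Suc i)) \<le> exp (L i)"
    and mom: "\<And>i k. k \<in> {nn i..<nn (Suc i)} \<Longrightarrow> integrable M (\<lambda>\<omega>. \<bar>X k \<omega>\<bar> powr b)"
       "\<And>i k. k \<in> {nn i..<nn (Suc i)} \<Longrightarrow> expectation (\<lambda>\<omega>. \<bar>X k \<omega>\<bar> powr b) \<le> exp (L i)"
    and sm: "summable (\<lambda>i. r i * sqrt (L i))"
    using blocks unfolding admissible_blocks_def r_def by auto
  have "(\<lambda>k. (cmod (a k))\<^sup>2) summable_on UNIV"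
    using a by (intro norm_summable_imp_summable_on) auto
  hence sa: "(\<lambda>k. (cmod (a k))\<^sup>2) summable_on A" for A
    by (rule summable_on_subset_banach) auto
  have inf0: "0 \<le> (\<Sum>\<^sub>\<infinity>k\<in>A. (cmod (a k))\<^sup>2)" for A by (rule infsum_nonneg) auto
  have r: "0 \<le> r i" "(\<Sum>k\<in>{nn i..<nn (Suc i)}. (cmod (a k))\<^sup>2) \<le> (r i)\<^sup>2" for i
    unfolding r_def real_sqrt_pow2[OF inf0] using inf0 by (auto intro!: finite_sum_le_infsum sa)
  define C where "C = 4 * (1 + sqrt (5 + 3 / b))"
  have C: "C \<ge> 0" using b by (simp add: C_def)
  have "AE \<omega> in M. \<forall>\<^sub>F i in sequentially. \<forall>m\<in>{nn i..nn (Suc i)}. \<forall>t.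
     cmod (centred_sum M X a {nn i..<m} t \<omega>) \<le> C * r i * sqrt (L i * ln (\<bar>t\<bar> + 3))"
    unfolding C_def by (rule AE_centred_sum_blocks[OF indep b L mom r])
  thus ?thesis
  proof eventually_elim
    case (elim \<omega>)
    have diff: "centred_sum M X a {..<m} t \<omega> - centred_sum M X a {..<n} t \<omega> = centred_sum M X a {n..<m} t \<omega>"
      if "n \<le> m" for n m t
      unfolding centred_sum_def using sum_diff_nat_ivl[of 0 n m] that by (simp add: atLeast0LessThan)
    have "\<exists>N. \<forall>n\<ge>N. \<forall>m\<ge>n. \<forall>t. cmod (centred_sum M X a {..<m} t \<omega> - centred_sum M X a {..<n} t \<omega>)
        \<le> \<epsilon> * sqrt (ln (\<bar>t\<bar> + 3))" if "\<epsilon> > 0" for \<epsilon>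
    proof (rule uniformly_Cauchy_of_blocks[OF _ nn _ _ _ that])
      show "0 \<le> sqrt (ln (\<bar>t\<bar> + 3))" for t :: real using one_le_ln_add_3[of t] by simp
      show "0 \<le> C * (r i * sqrt (L i))" for i using C r(1)[of i] L(1)[of i] by simp
      show "summable (\<lambda>i. C * (r i * sqrt (L i)))" by (intro summable_mult sm)
      show "\<forall>\<^sub>F i in sequentially. \<forall>m\<in>{nn i..nn (Suc i)}. \<forall>t.
         cmod (centred_sum M X a {..<m} t \<omega> - centred_sum M X a {..<nn i} t \<omega>)
         \<le> C * (r i * sqrt (L i)) * sqrt (ln (\<bar>t\<bar> + 3))"
        using elim by eventually_elim (simp add: diff real_sqrt_mult mult_ac)
    qed
    thus ?case by (simp add: diff cong: all_cong)
  qed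
qed

end

section \<open>Continuity away from 0 and the almost sure event\<close>

text \<open>Continuity is local: the closed ball of radius \<bar>x\<bar> / 2 about a nonzero
  \<open>x\<close> is compact and misses 0.\<close>

lemma continuous_on_Compl_zeroI:
  fixes g :: "real \<Rightarrow> 'b :: topological_space"
  assumes "\<And>K. compact K \<Longrightarrow> 0 \<notin> K \<Longrightarrow> continuous_on K g"
  shows "continuous_on (UNIV - {0}) g"
proof (rule continuous_at_imp_continuous_on, rule ballI)
  fix x :: real assume "x \<in> UNIV - {0}"
  hence x: "\<bar>x\<bar> / 2 > 0" "0 \<notin> cball x (\<bar>x\<bar> / 2)" by (auto simp: dist_real_def)
  have "continuous_on (cball x (\<bar>x\<bar> / 2)) g" by (intro assms x compact_cball)
  thus "isCont g x"
    by (rule continuous_on_interior) (use x in \<open>simp add: interior_cball\<close>)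
qed

text \<open>Square summability of \<open>a\<close> is stated separately because an infinite sum that
  does not converge has the default value 0, so the weighted condition alone would not express
  finiteness of the tails. The suprema are taken in the extended nonnegative reals, where being
  finite is a genuine condition.\<close>

theorem corollary1p2:
  fixes M :: "'w measure" and X :: "nat \<Rightarrow> 'w \<Rightarrow> real"
    and c :: "nat \<Rightarrow> real" and a :: "nat \<Rightarrow> complex"
  assumes "prob_space M"
    and "prob_space.indep_vars M (\<lambda>_. borel) X UNIV"
    and "polynomial_case M X c \<or> subexponential_case M X c"
    and "\<And>K :: real set. compact K \<Longrightarrow> 0 \<notin> K \<Longrightarrow>
           (SUP N\<in>{1::nat..}. SUP \<alpha>\<in>K. SUP j\<in>UNIV - {0::int}.
              ennreal (cmod (\<Sum>k=0..N. phi M (X k) (of_int j * \<alpha>)))) < \<infinity>"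
    and "(\<lambda>k. (cmod (a k))\<^sup>2) summable_on UNIV"
    and "(\<lambda>n. sqrt (\<Sum>\<^sub>\<infinity>k\<in>{n..}. (cmod (a k))\<^sup>2) / (real n * c n)) summable_on {1..}"
    and "(\<lambda>k. cmod (a k - a (k + 1))) summable_on {1..}"
  shows "\<exists>\<Omega>0\<in>sets M. measure M \<Omega>0 = 1 \<and>
           (\<forall>\<omega>\<in>\<Omega>0. \<forall>f\<in>B_space. integral {0..1} f = 0 \<longrightarrow>
              (\<forall>\<alpha>. \<alpha> \<noteq> 0 \<longrightarrow> summable (\<lambda>k. a k * f (\<alpha> * X k \<omega>))) \<and>
              continuous_on (UNIV - {0}) (\<lambda>\<alpha>. \<Sum>k. a k * f (\<alpha> * X k \<omega>)) \<and>
              (\<forall>K. compact K \<and> 0 \<notin> K \<longrightarrow>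
                 uniform_limit K (\<lambda>N \<alpha>. \<Sum>k\<le>N. a k * f (\<alpha> * X k \<omega>))
                   (\<lambda>\<alpha>. \<Sum>k. a k * f (\<alpha> * X k \<omega>)) sequentially))"
proof -
  interpret prob_space M by fact
  note indep = assms(2) and phi_bound = assms(4) and a2 = assms(5) and weighted = assms(6) and bv = assms(7)
  have X: "X k \<in> borel_measurable M" for k
    using indep by (auto simp: indep_vars_def)
  define h where "h n = sqrt (\<Sum>\<^sub>\<infinity>k\<in>{n..}. (cmod (a k))\<^sup>2)" for n
  have sa: "(\<lambda>k. (cmod (a k))\<^sup>2) summable_on A" for A
    by (rule summable_on_subset_banach[OF a2]) auto
  have h: "h n \<le> h m" if "m \<le> n" for m n
    unfolding h_def by (intro real_sqrt_le_mono infsum_mono2 sa) (use that in auto)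
  have h0: "0 \<le> h n" for n
    unfolding h_def by (intro real_sqrt_ge_zero infsum_nonneg) auto
  have "\<exists>b nn L. admissible_blocks X h b nn L"
    using assms(3)
  proof
    assume "polynomial_case M X c"
    thus ?thesis by (rule admissible_blocks_polynomial[OF X _ h h0 weighted[folded h_def]])
  next
    assume "subexponential_case M X c"
    thus ?thesis by (rule admissible_blocks_subexponential[OF X _ h h0 weighted[folded h_def]])
  qed
  then obtain b nn L where blocks: "admissible_blocks X h b nn L" by blast
  have sum_a2: "summable (\<lambda>k. (cmod (a k))\<^sup>2)"
    by (rule summable_on_imp_summable[OF a2])
  have a0: "a \<longlonglongrightarrow> 0"
    using summable_LIMSEQ_zero[OF sum_a2] by (simp add: tendsto_norm_zero_iff)
  have sum_bv: "summable (\<lambda>k. cmod (a k - a (Suc k)))"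
  proof -
    have "(\<lambda>k. cmod (a k - a (Suc k))) summable_on insert 0 {1..}"
      using bv by (subst summable_on_insert_iff) simp
    also have "insert 0 {1..} = (UNIV :: nat set)" by auto
    finally show ?thesis by (rule summable_on_imp_summable)
  qed
  \<comment> \<open>The estimate speaks of frequencies \<open>t\<close> only, so \<Omega>0 is fixed
    before \<open>f\<close> and \<open>K\<close>.\<close>
  obtain \<Omega>0 where sub: "\<Omega>0 \<subseteq> {\<omega>\<in>space M. \<forall>\<epsilon>>0. \<exists>N. \<forall>n\<ge>N. \<forall>m\<ge>n. \<forall>t.
       cmod (centred_sum M X a {n..<m} t \<omega>) \<le> \<epsilon> * sqrt (ln (\<bar>t\<bar> + 3))}"
    and \<Omega>0: "\<Omega>0 \<in> sets M" "prob \<Omega>0 = 1"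
    by (rule AE_E_prob[OF AE_centred_sum_uniformly_Cauchy[OF indep sum_a2 blocks[unfolded h_def[abs_def]]]])
  show ?thesis
  proof (intro bexI[of _ \<Omega>0] conjI ballI allI impI)
    fix \<omega> f assume \<omega>: "\<omega> \<in> \<Omega>0" and f: "f \<in> B_space" "integral {0..1} f = 0"
    let ?F = "\<lambda>\<alpha>. \<Sum>k. a k * f (\<alpha> * X k \<omega>)"
    have conv: "uniformly_convergent_on K (\<lambda>N \<alpha>. \<Sum>k<N. a k * f (\<alpha> * X k \<omega>))"
      if K: "compact K" "0 \<notin> K" for K
    proof -
      obtain B where B: "\<And>N \<alpha> j::int. \<alpha> \<in> K \<Longrightarrow> j \<noteq> 0 \<Longrightarrow> cmod (\<Sum>k\<le>N. phi M (X k) (of_int j * \<alpha>)) \<le> B"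
        using phi_sums_bounded[OF phi_bound[OF K]] by metis
      show ?thesis
        by (rule uniformly_convergent_random_series[where \<psi> = "\<lambda>k. phi M (X k)" and B = B,
              OF a0 sum_bv _ B f compact_imp_bounded[OF K(1)]])
           (use subsetD[OF sub \<omega>] in \<open>simp_all add: centred_sum_def\<close>)
    qed
    have summ: "summable (\<lambda>k. a k * f (\<alpha> * X k \<omega>))" if "\<alpha> \<noteq> 0" for \<alpha>
      \<comment> \<open>Pointwise convergence is uniform convergence on the compact set
        {\<alpha>}.\<close>
      using conv[of "{\<alpha>}"] that
      by (simp add: uniformly_convergent_on_singleton summable_iff_convergent)
    show "summable (\<lambda>k. a k * f (\<alpha> * X k \<omega>))" if "\<alpha> \<noteq> 0" for \<alpha> by (rule summ) fact
    have lim: "uniform_limit K (\<lambda>N \<alpha>. \<Sum>k<N. a k * f (\<alpha> * X k \<omega>)) ?F sequentially"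
      if K: "compact K" "0 \<notin> K" for K
      using conv[OF K] unfolding uniformly_convergent_uniform_limit_iff suminf_eq_lim .
    show "uniform_limit K (\<lambda>N \<alpha>. \<Sum>k\<le>N. a k * f (\<alpha> * X k \<omega>)) ?F sequentially"
      if "compact K \<and> 0 \<notin> K" for K
      using filterlim_compose[OF lim[of K] filterlim_Suc] that by (simp add: lessThan_Suc_atMost)
    show "continuous_on (UNIV - {0}) ?F"
    proof (rule continuous_on_Compl_zeroI)
      fix K :: "real set" assume K: "compact K" "0 \<notin> K"
      show "continuous_on K ?F"
        by (rule uniform_limit_theorem[OF _ lim[OF K]])
           (auto intro!: always_eventually continuous_intros
             continuous_on_compose2[OF B_space_continuous_on[OF f(1), of UNIV]])
    qed
  qed (use \<Omega>0 in auto)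
qed

end
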